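(* Let $(\Omega,\mathcal F,\mu)$ be a complete probability space with a filtration $(\mathcal F_n)_{n\ge 0}$ such that $\mathcal F=\bigvee_{n\ge0}\mathcal F_n$. Let $1<p_i<\infty$ $(i\in\mathbb N)$ with $\frac1p=\sum_{i=1}^\infty\frac1{p_i}$, $0<p<\infty$, let $\overrightarrow\omega=(\omega_1,\omega_2,\dots)$ be a sequence of weights satisfying the standing assumptions (A1)–(A4) listed in the context, and let $v$ be a weight. Suppose $\overrightarrow\omega\in RH_{\overrightarrow p}$. Then the following statements are equivalent: (1) There exists a positive constant $C$ such that $$\Big(\int_{\{\tau<\infty\}}\prod_{i=1}^{\infty}E_\tau(f_i)^p\,v\,d\mu\Big)^{\frac1p}\le C\prod_{i=1}^\infty\|f_i\|_{L^{p_i}(\omega_i)}$$ for every stopping time $\tau\in\mathcal T$ and all nonnegative $f_i\in L^{p_i}(\omega_i)$, $i\in\mathbb N$, with $\prod_{i=1}^\infty\|f_i\|_{L^{p_i}(\omega_i)}<\infty$. (2) There exists a positive constant $C$ such that $$\|\mathfrak M(\overrightarrow f)\|_{L^{p,\infty}(v)}\le C\prod_{i=1}^\infty\|f_i\|_{L^{p_i}(\omega_i)}$$ for all nonnegative $f_i\in L^{p_i}(\omega_i)$, $i\in\mathbb N$, with $\prod_{i=1}^\infty\|f_i\|_{L^{p_i}(\omega_i)}<\infty$, where $\overrightarrow f=(f_1,f_2,\dots)$. (3) $(v,\overrightarrow\omega)\in A_{\overrightarrow p}$, i.e. there exists a positive constant $C$ such that, almost everywhere, $$E_n(v)^{\frac1p}\prod_{i=1}^\infty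 E_n(\omega_i^{1-p_i'})^{\frac1{p_i'}}\le C,\qquad\forall n\ge0 .$$
   Context: Conventions: $\mathbb N=\{1,2,\dots\}$; statements about functions are understood almost everywhere. For a sequence $(c_i)$ of finite nonnegative numbers, $\prod_{i=1}^\infty c_i$ denotes $\lim_{n\to\infty}\prod_{i=1}^n c_i$ when this limit exists in $[0,\infty)$ (the value $0$ is allowed); "$\prod_{i=1}^\infty c_i<\infty$" means that this finite limit exists. Infinite products of functions are taken pointwise a.e. Probability setting: $(\mathcal F_n)_{n\ge0}$ is an increasing sequence of sub-$\sigma$-fields of $\mathcal F$. $E_n(f)=E(f\mid\mathcal F_n)$. $\mathcal T$ is the set of all stopping times $\tau:\Omega\to\{0,1,2,\dots\}\cup\{\infty\}$; $\mathcal F_\tau=\{F\in\mathcal F: F\cap\{\tau\le n\}\in\mathcal F_n\ \forall n\ge0\}$ and $E_\tau(f)=E(f\mid\mathcal F_\tau)$ (so $E_\tau(f)=E_n(f)$ on $\{\tau=n\}$). A weight is a random variable $\omega$ with $\omega>0$ and $E(\omega)<\infty$. For a weight $\omega$: $|B|_\omega=\int_B\omega\,d\mu$; $\|f\|_{L^q(\omega)}=(\int_\Omega|f|^q\omega\,d\mu)^{1/q}$; $\|f\|_{L^{q,\infty}(\omega)}=\sup_{\lambda>0}\lambda\,|\{|f|>\lambda\}|_\omega^{1/q}$. $\overrightarrow p=(p_1,p_2,\dots)$, $\frac1{p_i}+\frac1{p_i'}=1$, and $\sigma_i=\omega_i^{-\frac1{p_i-1}}=\omega_i^{1-p_i'}$.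 Standing assumptions: (A1) $\sigma_i\in L^1$ for all $i\in\mathbb N$; (A2) $\prod_{i=1}^\infty\|\sigma_i\|_{L^{p_i}(\omega_i)}<\infty$; (A3) for every $n\ge0$, $\prod_{i=1}^\infty E_n(\omega_i^{1-p_i'})^{1/p_i'}<\infty$ a.e.; (A4) $\prod_{i=1}^\infty\sigma_i^{1/p_i}>0$ a.e. Generalized Doob maximal operator: $\mathfrak M(\overrightarrow f)=\sup_{n\ge0}\prod_{i=1}^\infty|E_n(f_i)|$. (Under the standing assumptions and $\prod_i\|f_i\|_{L^{p_i}(\omega_i)}<\infty$ the products converge a.e., so this is well defined.) Reverse Hölder condition: $\overrightarrow\omega\in RH_{\overrightarrow p}$ means there is a positive constant $C$ such that $$\prod_{i=1}^\infty\Big(\int_{\{\tau<\infty\}}\sigma_i\,d\mu\Big)^{\frac p{p_i}}\le C\int_{\{\tau<\infty\}}\prod_{i=1}^\infty\sigma_i^{\frac p{p_i}}\,d\mu,\qquad\forall\tau\in\mathcal T.$$ *)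

theory Defs
  imports "HOL-Probability.Probability"
begin

text \<open>Throughout, sequences are indexed by \<open>nat\<close> starting at \<open>0\<close>, so that the entry with index
  \<open>i\<close> is the one usually numbered \<open>i + 1\<close>. All functions are understood up to null sets; in
  particular positivity and nonnegativity of functions are almost everywhere statements.\<close>

section \<open>Infinite products of nonnegative numbers\<close>

text \<open>An infinite product is the limit of its partial products, and the value \<open>0\<close> is an ordinary
  value. The library notions \<^const>\<open>convergent_prod\<close> and \<^const>\<open>prodinf\<close> do not fit, as they
  require a nonzero limit up to finitely many zero factors. For nonnegative factors,
  \<open>prod_converges c\<close> says that the product exists in $[0,\infty)$.\<close>

definition prod_converges :: "(nat \<Rightarrow> real) \<Rightarrow> bool" where
  "prod_converges c \<longleftrightarrow> convergent (\<lambda>n. \<Prod>i<n. c i)"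

definition infprod :: "(nat \<Rightarrow> real) \<Rightarrow> real" where
  "infprod c = lim (\<lambda>n. \<Prod>i<n. c i)"

text \<open>Power of an extended nonnegative number, for an exponent \<open>r > 0\<close>.\<close>

definition ennreal_powr :: "ennreal \<Rightarrow> real \<Rightarrow> ennreal" where
  "ennreal_powr x r = (if x = \<infinity> then \<infinity> else ennreal (enn2real x powr r))"

section \<open>Stopping times with values in $\{0,1,2,\dots\}\cup\{\infty\}$\<close>

text \<open>The library's \<^const>\<open>stopping_time\<close> takes values in the index type of the filtration and hence
  does not provide the value \<open>\<infinity>\<close> for a filtration indexed by \<open>nat\<close>.\<close>

definition ext_stopping_time :: "'a measure \<Rightarrow> (nat \<Rightarrow> 'a measure) \<Rightarrow> ('a \<Rightarrow> enat) \<Rightarrow> bool" where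
  "ext_stopping_time M F \<tau> \<longleftrightarrow> (\<forall>n. {x \<in> space M. \<tau> x \<le> enat n} \<in> sets (F n))"

definition stopped_algebra :: "'a measure \<Rightarrow> (nat \<Rightarrow> 'a measure) \<Rightarrow> ('a \<Rightarrow> enat) \<Rightarrow> 'a measure" where
  "stopped_algebra M F \<tau> =
     sigma (space M) {A \<in> sets M. \<forall>n. A \<inter> {x \<in> space M. \<tau> x \<le> enat n} \<in> sets (F n)}"

definition finite_event :: "'a measure \<Rightarrow> ('a \<Rightarrow> enat) \<Rightarrow> 'a set" where
  "finite_event M \<tau> = {x \<in> space M. \<tau> x < \<infinity>}"

section \<open>Weights and weighted spaces\<close>

definition weight :: "'a measure \<Rightarrow> ('a \<Rightarrow> real) \<Rightarrow> bool" where
  "weight M w \<longleftrightarrow> w \<in> borel_measurable M \<and> (AE x in M. w x > 0) \<and> integrable M w"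

definition weighted_measure :: "'a measure \<Rightarrow> ('a \<Rightarrow> real) \<Rightarrow> 'a set \<Rightarrow> ennreal" where
  "weighted_measure M w B = (\<integral>\<^sup>+x\<in>B. ennreal (w x) \<partial>M)"

definition in_Lq :: "'a measure \<Rightarrow> real \<Rightarrow> ('a \<Rightarrow> real) \<Rightarrow> ('a \<Rightarrow> real) \<Rightarrow> bool" where
  "in_Lq M q w f \<longleftrightarrow> f \<in> borel_measurable M \<and> integrable M (\<lambda>x. \<bar>f x\<bar> powr q * w x)"

text \<open>Only meaningful for \<open>f\<close> with \<open>in_Lq M q w f\<close>; otherwise the integral defaults to \<open>0\<close>.\<close>

definition Lq_norm :: "'a measure \<Rightarrow> real \<Rightarrow> ('a \<Rightarrow> real) \<Rightarrow> ('a \<Rightarrow> real) \<Rightarrow> real" where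
  "Lq_norm M q w f = (\<integral>x. \<bar>f x\<bar> powr q * w x \<partial>M) powr (1 / q)"

text \<open>The function is \<open>[0,\<infinity>]\<close>-valued since it is applied to a supremum.\<close>

definition weak_Lq_norm :: "'a measure \<Rightarrow> real \<Rightarrow> ('a \<Rightarrow> real) \<Rightarrow> ('a \<Rightarrow> ennreal) \<Rightarrow> ennreal" where
  "weak_Lq_norm M q w g =
     (SUP t\<in>{0::real<..}. ennreal t *
        ennreal_powr (weighted_measure M w {x \<in> space M. g x > ennreal t}) (1 / q))"

definition conj_exp :: "real \<Rightarrow> real" where
  "conj_exp q = q / (q - 1)"

lemma conj_exp_eq: "1 < q \<Longrightarrow> 1 / q + 1 / conj_exp q = 1"
  by (simp add: conj_exp_def field_simps)

text \<open>\<open>dual_weight q w\<close> is the weight $\sigma = w^{-1/(q-1)}$.\<close>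

definition dual_weight :: "real \<Rightarrow> ('a \<Rightarrow> real) \<Rightarrow> 'a \<Rightarrow> real" where
  "dual_weight q w = (\<lambda>x. w x powr (- 1 / (q - 1)))"

lemma dual_weight_eq: "1 < q \<Longrightarrow> dual_weight q w x = w x powr (1 - conj_exp q)"
  by (simp add: dual_weight_def conj_exp_def field_simps)

section \<open>Maximal operator and weight classes\<close>

text \<open>The sequences $\overrightarrow f$ of nonnegative $f_i \in L^{p_i}(\omega_i)$ for which the product
  of the norms is finite.\<close>

definition test_sequence ::
  "'a measure \<Rightarrow> (nat \<Rightarrow> real) \<Rightarrow> (nat \<Rightarrow> 'a \<Rightarrow> real) \<Rightarrow> (nat \<Rightarrow> 'a \<Rightarrow> real) \<Rightarrow> bool" where
  "test_sequence M ps \<omega> f \<longleftrightarrow>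
     (\<forall>i. in_Lq M (ps i) (\<omega> i) (f i) \<and> (AE x in M. f i x \<ge> 0)) \<and>
     prod_converges (\<lambda>i. Lq_norm M (ps i) (\<omega> i) (f i))"

definition doob_maximal ::
  "'a measure \<Rightarrow> (nat \<Rightarrow> 'a measure) \<Rightarrow> (nat \<Rightarrow> 'a \<Rightarrow> real) \<Rightarrow> 'a \<Rightarrow> ennreal" where
  "doob_maximal M F f = (\<lambda>x. SUP n. ennreal (infprod (\<lambda>i. \<bar>real_cond_exp M (F n) (f i) x\<bar>)))"

definition reverse_Hoelder ::
  "'a measure \<Rightarrow> (nat \<Rightarrow> 'a measure) \<Rightarrow> real \<Rightarrow> (nat \<Rightarrow> real) \<Rightarrow> (nat \<Rightarrow> 'a \<Rightarrow> real) \<Rightarrow> bool" where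
  "reverse_Hoelder M F p ps \<omega> \<longleftrightarrow>
     (\<exists>C>0. \<forall>\<tau>. ext_stopping_time M F \<tau> \<longrightarrow>
        ennreal (infprod (\<lambda>i. (LINT x:finite_event M \<tau>|M. dual_weight (ps i) (\<omega> i) x) powr (p / ps i)))
        \<le> ennreal C *
          (\<integral>\<^sup>+x\<in>finite_event M \<tau>.
             ennreal (infprod (\<lambda>i. dual_weight (ps i) (\<omega> i) x powr (p / ps i))) \<partial>M))"

definition A_class ::
  "'a measure \<Rightarrow> (nat \<Rightarrow> 'a measure) \<Rightarrow> real \<Rightarrow> (nat \<Rightarrow> real) \<Rightarrow> ('a \<Rightarrow> real) \<Rightarrow> (nat \<Rightarrow> 'a \<Rightarrow> real) \<Rightarrow> bool"
  where
  "A_class M F p ps v \<omega> \<longleftrightarrow>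
     (\<exists>C>0. AE x in M. \<forall>n.
        real_cond_exp M (F n) v x powr (1 / p) *
        infprod (\<lambda>i. real_cond_exp M (F n) (\<lambda>y. \<omega> i y powr (1 - conj_exp (ps i))) x
                       powr (1 / conj_exp (ps i))) \<le> C)"

end

theory Submission
  imports Defs
begin

text \<open>
  Write \<open>E\<^sub>n\<close> for the conditional expectation at time \<open>n\<close>, \<open>\<sigma> i\<close> for the dual weights and \<open>a i\<close> for
  the mass \<open>\<bar>f i\<bar>\<^sup>r \<omega> i\<close> with \<open>r = ps i\<close>. The analytic core is Hoelder's inequality for infinitely
  many functions, with exponents \<open>\<theta> i\<close> of sum \<open>1\<close>. After normalisation it is the weighted inequality
  between the arithmetic and the geometric mean, \<open>infprod (\<lambda>i. h i powr \<theta> i) \<le> (\<Sum>i. \<theta> i * h i)\<close>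
  (\<open>infprod_powr_le_suminf\<close>), integrated term by term (\<open>Hoelder_infprod_normalised\<close>). It has an
  unconditional and a conditional form, and it yields the convergence of the infinite products as
  well as the inequality.

  The three statements are proved equivalent in a cycle.

  \<^item> From the stopped inequality to the weak-type inequality (\<open>weak_type_of_stopped_bound\<close>): stop when
    the product of the \<open>E\<^sub>n(f i)\<close> first exceeds the given level.

  \<^item> From the weak-type inequality to the \<open>A\<close> condition (\<open>A_condition_of_weak_type\<close>): test with the dual
    weights restricted to a set \<open>B\<close> of \<open>F n\<close>. The product of their norms has as \<open>p\<close>-th power the product
    of powers of integrals that the reverse Hoelder condition bounds by a single integral over \<open>B\<close>.
    As \<open>B\<close> is arbitrary, this localises to a pointwise inequality for conditional expectations,
    from which a positive factor cancels.

  \<^item> From the \<open>A\<close> condition to the stopped inequality (\<open>stopped_bound_of_A_condition\<close>): the conditional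
    Hoelder inequality at the stopping time splits the product of the conditional expectations of the
    \<open>f i\<close> into a product of powers of those of the \<open>a i\<close> and one of those of the \<open>\<sigma> i\<close>
    (\<open>cond_product_bound\<close>). The \<open>A\<close> condition absorbs the latter together with \<open>v\<close>, and the
    unconditional Hoelder inequality integrates the former.

  The stopped algebra is treated as one more sub-\<open>\<sigma>\<close>-algebra, so that the conditional inequalities
  apply to it directly; \<open>real_cond_exp_stopped_algebra\<close> transfers hypotheses on the \<open>E\<^sub>n\<close> to it.
\<close>

section \<open>Infinite products of nonnegative numbers\<close>

lemma infprod_LIMSEQ:
  "prod_converges c \<Longrightarrow> (\<lambda>n. \<Prod>i<n. c i) \<longlonglongrightarrow> infprod c"
  unfolding prod_converges_def infprod_def by (simp add: convergent_LIMSEQ_iff)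

lemma infprod_eqI:
  assumes "(\<lambda>n. \<Prod>i<n. c i) \<longlonglongrightarrow> L"
  shows "prod_converges c" "infprod c = L"
  using assms unfolding prod_converges_def infprod_def by (auto simp: convergent_def limI)

lemma infprod_nonneg:
  assumes "prod_converges c" "\<And>i. 0 \<le> c i"
  shows "0 \<le> infprod c"
  using infprod_LIMSEQ[OF assms(1)] by (rule LIMSEQ_le_const) (auto intro!: prod_nonneg assms(2))

lemma infprod_mult:
  assumes "prod_converges a" "prod_converges b"
  shows "prod_converges (\<lambda>i. a i * b i)" "infprod (\<lambda>i. a i * b i) = infprod a * infprod b"
proof -
  have "(\<lambda>n. \<Prod>i<n. a i * b i) \<longlonglongrightarrow> infprod a * infprod b"
    unfolding prod.distrib by (intro tendsto_mult infprod_LIMSEQ assms)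
  from infprod_eqI[OF this] show "prod_converges (\<lambda>i. a i * b i)"
    "infprod (\<lambda>i. a i * b i) = infprod a * infprod b" by auto
qed

lemma infprod_powr:
  assumes "prod_converges c" "\<And>i. 0 \<le> c i" "0 < r"
  shows "prod_converges (\<lambda>i. c i powr r)" "infprod (\<lambda>i. c i powr r) = infprod c powr r"
proof -
  have "(\<lambda>n. (\<Prod>i<n. c i) powr r) \<longlonglongrightarrow> infprod c powr r"
    using assms by (intro tendsto_powr' infprod_LIMSEQ) (auto intro!: prod_nonneg always_eventually)
  then have "(\<lambda>n. \<Prod>i<n. c i powr r) \<longlonglongrightarrow> infprod c powr r"
    by (simp add: prod_powr_distrib assms)
  from infprod_eqI[OF this] show "prod_converges (\<lambda>i. c i powr r)"
    "infprod (\<lambda>i. c i powr r) = infprod c powr r" by auto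
qed

lemma infprod_zero_factor:
  assumes "c k = 0"
  shows "prod_converges c" "infprod c = 0"
proof -
  have "(\<lambda>n. \<Prod>i<n. c i) \<longlonglongrightarrow> 0"
    by (rule tendsto_eventually, rule eventually_mono[OF eventually_gt_at_top[of k]])
      (use assms in auto)
  from infprod_eqI[OF this] show "prod_converges c" "infprod c = 0" by auto
qed

lemma infprod_mono:
  assumes "prod_converges a" "prod_converges b" "\<And>i. 0 \<le> a i" "\<And>i. a i \<le> b i"
  shows "infprod a \<le> infprod b"
  by (rule LIMSEQ_le[OF infprod_LIMSEQ[OF assms(1)] infprod_LIMSEQ[OF assms(2)]])
    (auto intro!: prod_mono simp: assms)

text \<open>Comparison: \<open>a i = \<theta> i * b i\<close> with factors \<open>\<theta> i\<close> in the unit interval, and the partial products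
  of \<open>\<theta>\<close> decrease.\<close>

lemma prod_converges_comparison:
  assumes b: "prod_converges b" and nonneg: "\<And>i. 0 \<le> a i" and le: "\<And>i. a i \<le> b i"
  shows "prod_converges a"
proof -
  define \<theta> where "\<theta> i = a i / b i" for i
  have \<theta>: "0 \<le> \<theta> i" "\<theta> i \<le> 1" "a i = \<theta> i * b i" for i
  proof -
    show "0 \<le> \<theta> i" "\<theta> i \<le> 1"
      using nonneg[of i] le[of i] by (auto simp: \<theta>_def divide_simps)
    show "a i = \<theta> i * b i"
      using nonneg[of i] le[of i] by (auto simp: \<theta>_def)
  qed
  have "decseq (\<lambda>n. \<Prod>i<n. \<theta> i)"
    by (rule decseq_SucI) (auto intro!: mult_left_le prod_nonneg \<theta>)
  then have "convergent (\<lambda>n. \<Prod>i<n. \<theta> i)"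
    by (rule decseq_convergent[where B=0]) (auto intro!: prod_nonneg \<theta> simp: convergent_def)
  then have "prod_converges \<theta>" by (simp add: prod_converges_def)
  from infprod_mult(1)[OF this b] show ?thesis by (simp flip: \<theta>(3))
qed

text \<open>Each factor is at most \<open>exp (\<theta> i * h i)\<close>, and the product of these exponentials converges.\<close>

lemma prod_converges_powr_of_summable:
  assumes \<theta>: "\<And>i. 0 \<le> \<theta> i" and h: "\<And>i. 0 \<le> h i" and s: "summable (\<lambda>i. \<theta> i * h i)"
  shows "prod_converges (\<lambda>i. h i powr \<theta> i)"
proof (rule prod_converges_comparison)
  have "(\<lambda>n. exp (\<Sum>i<n. \<theta> i * h i)) \<longlonglongrightarrow> exp (suminf (\<lambda>i. \<theta> i * h i))"
    by (intro tendsto_exp summable_LIMSEQ s)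
  then have "(\<lambda>n. \<Prod>i<n. exp (\<theta> i * h i)) \<longlonglongrightarrow> exp (suminf (\<lambda>i. \<theta> i * h i))"
    by (simp add: exp_sum)
  then show "prod_converges (\<lambda>i. exp (\<theta> i * h i))" by (rule infprod_eqI)
  show "h i powr \<theta> i \<le> exp (\<theta> i * h i)" for i
  proof (cases "h i = 0")
    case False
    then have "ln (h i) \<le> h i" using h[of i] ln_le_minus_one[of "h i"] by linarith
    then show ?thesis using False \<theta>[of i] by (simp add: powr_def mult_left_mono)
  qed simp
qed simp

text \<open>The weighted inequality between the arithmetic and the geometric mean of infinitely many
  numbers. With \<open>H\<close> the arithmetic mean, it follows from \<open>h \<le> H * exp (h / H - 1)\<close>: raised to the
  power \<open>\<theta> i\<close> and multiplied over \<open>i\<close>, the exponential factors cancel.\<close>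

lemma infprod_powr_le_suminf:
  assumes \<theta>: "\<And>i. 0 \<le> \<theta> i" and h: "\<And>i. 0 \<le> h i" and s: "summable (\<lambda>i. \<theta> i * h i)"
    and sums: "\<theta> sums 1"
  shows "infprod (\<lambda>i. h i powr \<theta> i) \<le> (\<Sum>i. \<theta> i * h i)"
proof -
  define H where "H = (\<Sum>i. \<theta> i * h i)"
  have H0: "0 \<le> H" unfolding H_def by (intro suminf_nonneg s) (simp add: \<theta> h)
  show ?thesis
  proof (cases "H = 0")
    case True
    then have 0: "\<theta> i * h i = 0" for i
      using suminf_eq_zero_iff[OF s] \<theta> h by (simp add: H_def)
    obtain k where "\<theta> k \<noteq> 0"
    proof (rule ccontr)
      assume "\<not> thesis"
      with that have "\<theta> = (\<lambda>_. 0)" by auto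
      with sums_unique2[OF sums, of 0] show False by simp
    qed
    with 0[of k] have "h k powr \<theta> k = 0" by simp
    then have "infprod (\<lambda>i. h i powr \<theta> i) = 0" by (rule infprod_zero_factor)
    then show ?thesis using H0 by (simp add: H_def)
  next
    case False
    with H0 have H: "0 < H" by simp
    \<comment> \<open>The logarithm of the bound \<open>H * exp (h i / H - 1)\<close>, multiplied by \<open>\<theta> i\<close>.\<close>
    let ?e = "\<lambda>i. exp (\<theta> i * (ln H - 1) + \<theta> i * h i / H)"
    have "(\<lambda>i. \<theta> i * (ln H - 1) + \<theta> i * h i / H) sums (1 * (ln H - 1) + H / H)"
      unfolding H_def by (intro sums_add sums_mult2 sums_divide summable_sums sums s)
    then have "(\<lambda>i. \<theta> i * (ln H - 1) + \<theta> i * h i / H) sums ln H" using H by simp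
    then have "(\<lambda>n. exp (\<Sum>i<n. \<theta> i * (ln H - 1) + \<theta> i * h i / H)) \<longlonglongrightarrow> exp (ln H)"
      unfolding sums_def by (rule tendsto_exp)
    then have "(\<lambda>n. \<Prod>i<n. ?e i) \<longlonglongrightarrow> H" using H by (simp add: exp_sum)
    note e = infprod_eqI[OF this]
    have "infprod (\<lambda>i. h i powr \<theta> i) \<le> infprod ?e"
    proof (rule infprod_mono)
      show "prod_converges (\<lambda>i. h i powr \<theta> i)"
        by (rule prod_converges_powr_of_summable[OF \<theta> h s])
      show "h i powr \<theta> i \<le> ?e i" for i
      proof (cases "h i = 0")
        case False
        with h[of i] have hi: "0 < h i" by simp
        have "ln (h i / H) \<le> h i / H - 1" using hi H by (intro ln_le_minus_one) simp
        then have "ln (h i) \<le> (ln H - 1) + h i / H" using hi H by (simp add: ln_div)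
        from mult_left_mono[OF this \<theta>[of i]] show ?thesis
          using False by (simp add: powr_def distrib_left)
      qed simp
    qed (use e in auto)
    then show ?thesis using e by (simp add: H_def)
  qed
qed

lemma infprod_two_factors:
  assumes "\<And>i. 2 \<le> i \<Longrightarrow> c i = 1"
  shows "prod_converges c" "infprod c = c 0 * c 1"
proof -
  have "(\<Prod>i<n. c i) = c 0 * c 1" if "2 \<le> n" for n
  proof -
    have "(\<Prod>i<n. c i) = (\<Prod>i\<in>{0,1}. c i)"
      by (rule prod.mono_neutral_right) (use that assms in auto)
    then show ?thesis by simp
  qed
  then have "(\<lambda>n. \<Prod>i<n. c i) \<longlonglongrightarrow> c 0 * c 1"
    by (intro tendsto_eventually eventually_mono[OF eventually_ge_at_top[of 2]]) auto
  from infprod_eqI[OF this] show "prod_converges c" "infprod c = c 0 * c 1" by auto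
qed

section \<open>Hoelder's inequality for infinitely many functions\<close>

lemma borel_measurable_infprod [measurable]:
  assumes "\<And>i. c i \<in> borel_measurable N"
  shows "(\<lambda>x. infprod (\<lambda>i. c i x)) \<in> borel_measurable N"
  unfolding infprod_def using assms by measurable

text \<open>The functions \<open>h i = g i / G i\<close> are normalised, so the product \<open>S\<close> of the powers of the \<open>g i\<close> is
  the product \<open>Q\<close> of the powers of the \<open>G i\<close> times the product of the powers of the \<open>h i\<close>, and the last
  factor is at most the mean \<open>\<Sum>i. \<theta> i * h i\<close>. Integrating this mean term by term gives the claim.
  The hypothesis \<open>h1\<close> makes the mean finite almost everywhere, whence the convergence, also where
  \<open>Q\<close> or \<open>u\<close> vanishes. Constant \<open>G i\<close> lead to the ordinary inequality and conditional expectations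
  to the conditional one.\<close>

lemma Hoelder_infprod_normalised:
  fixes g G :: "nat \<Rightarrow> 'a \<Rightarrow> real"
  assumes [measurable]: "\<And>i. g i \<in> borel_measurable M" "\<And>i. G i \<in> borel_measurable M"
    "u \<in> borel_measurable M"
    and g: "\<And>i. AE x in M. 0 \<le> g i x" and G: "\<And>i. AE x in M. 0 \<le> G i x"
    and zero: "\<And>i. AE x in M. G i x = 0 \<longrightarrow> g i x = 0"
    and \<theta>: "\<And>i. 0 \<le> \<theta> i" and sums: "\<theta> sums 1"
    and conv: "AE x in M. prod_converges (\<lambda>i. G i x powr \<theta> i)"
    and h1: "\<And>i. (\<integral>\<^sup>+x. ennreal (g i x / G i x) \<partial>M) \<le> 1"
    and hQ: "\<And>i. (\<integral>\<^sup>+x. u x * ennreal (infprod (\<lambda>i. G i x powr \<theta> i)) * ennreal (g i x / G i x) \<partial>M)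
        \<le> (\<integral>\<^sup>+x. u x * ennreal (infprod (\<lambda>i. G i x powr \<theta> i)) \<partial>M)"
  shows "AE x in M. prod_converges (\<lambda>i. g i x powr \<theta> i)"
    and "(\<integral>\<^sup>+x. u x * ennreal (infprod (\<lambda>i. g i x powr \<theta> i)) \<partial>M)
        \<le> (\<integral>\<^sup>+x. u x * ennreal (infprod (\<lambda>i. G i x powr \<theta> i)) \<partial>M)"
proof -
  define Q where "Q x = infprod (\<lambda>i. G i x powr \<theta> i)" for x
  define h where "h i x = g i x / G i x" for i x
  have [measurable]: "Q \<in> borel_measurable M" "\<And>i. h i \<in> borel_measurable M"
    unfolding Q_def h_def by measurable
  have mean: "(\<Sum>i. ennreal (\<theta> i)) = 1"
    using suminf_ennreal2[OF \<theta> sums_summable[OF sums]] sums_unique[OF sums] by simp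
  have mean_le: "(\<integral>\<^sup>+x. w x * (\<Sum>i. ennreal (\<theta> i) * ennreal (h i x)) \<partial>M) \<le> K"
    if [measurable]: "w \<in> borel_measurable M"
      and K: "\<And>i. (\<integral>\<^sup>+x. w x * ennreal (h i x) \<partial>M) \<le> K" for w K
  proof -
    have "(\<integral>\<^sup>+x. w x * (\<Sum>i. ennreal (\<theta> i) * ennreal (h i x)) \<partial>M)
        = (\<integral>\<^sup>+x. (\<Sum>i. ennreal (\<theta> i) * (w x * ennreal (h i x))) \<partial>M)"
      by (subst ennreal_suminf_cmult[symmetric]) (simp only: mult.left_commute)
    also have "\<dots> = (\<Sum>i. ennreal (\<theta> i) * (\<integral>\<^sup>+x. w x * ennreal (h i x) \<partial>M))"
      by (subst nn_integral_suminf) (auto simp: nn_integral_cmult)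
    also have "\<dots> \<le> (\<Sum>i. ennreal (\<theta> i) * K)"
      by (intro suminf_le mult_left_mono K) auto
    also have "\<dots> = K" by (simp add: ennreal_suminf_multc mean)
    finally show ?thesis .
  qed
  have "(\<integral>\<^sup>+x. 1 * (\<Sum>i. ennreal (\<theta> i) * ennreal (h i x)) \<partial>M) \<le> 1"
    by (rule mean_le) (use h1 in \<open>auto simp: h_def\<close>)
  then have "(\<integral>\<^sup>+x. (\<Sum>i. ennreal (\<theta> i) * ennreal (h i x)) \<partial>M) \<noteq> \<infinity>"
    by (auto simp: top_unique)
  then have fin: "AE x in M. (\<Sum>i. ennreal (\<theta> i) * ennreal (h i x)) \<noteq> \<infinity>"
    by (intro nn_integral_PInf_AE) auto
  have g': "AE x in M. \<forall>i. 0 \<le> g i x" and G': "AE x in M. \<forall>i. 0 \<le> G i x"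
    and zero': "AE x in M. \<forall>i. G i x = 0 \<longrightarrow> g i x = 0"
    using g G zero by (simp_all add: AE_all_countable)
  have pt: "AE x in M. prod_converges (\<lambda>i. g i x powr \<theta> i) \<and>
      ennreal (infprod (\<lambda>i. g i x powr \<theta> i))
        \<le> ennreal (Q x) * (\<Sum>i. ennreal (\<theta> i) * ennreal (h i x))"
    using fin g' G' zero' conv
  proof eventually_elim
    case (elim x)
    have h0: "0 \<le> h i x" for i using elim by (simp add: h_def)
    have gh: "g i x = G i x * h i x" for i using elim by (auto simp: h_def)
    have pr: "ennreal (\<theta> i) * ennreal (h i x) = ennreal (\<theta> i * h i x)" for i
      by (rule ennreal_mult[symmetric]) (auto simp: \<theta> h0)
    have sm: "summable (\<lambda>i. \<theta> i * h i x)"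
      using elim(1) unfolding pr by (intro summable_suminf_not_top) (auto simp: \<theta> h0)
    note c = prod_converges_powr_of_summable[OF \<theta> h0 sm]
    have "0 \<le> Q x" unfolding Q_def by (rule infprod_nonneg) (use elim in auto)
    moreover have eq: "(\<lambda>i. g i x powr \<theta> i) = (\<lambda>i. G i x powr \<theta> i * h i x powr \<theta> i)"
      using elim h0 by (simp add: gh powr_mult)
    moreover have "(\<Sum>i. ennreal (\<theta> i) * ennreal (h i x)) = ennreal (\<Sum>i. \<theta> i * h i x)"
      unfolding pr by (rule suminf_ennreal2) (auto simp: \<theta> h0 sm)
    ultimately show ?case
      using infprod_mult[OF elim(5) c] infprod_powr_le_suminf[OF \<theta> h0 sm sums]
        suminf_nonneg[OF sm] \<theta> h0
      by (auto simp: Q_def[symmetric] ennreal_mult[symmetric] intro!: mult_left_mono)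
  qed
  then show "AE x in M. prod_converges (\<lambda>i. g i x powr \<theta> i)" by auto
  have "(\<integral>\<^sup>+x. u x * ennreal (infprod (\<lambda>i. g i x powr \<theta> i)) \<partial>M)
      \<le> (\<integral>\<^sup>+x. (u x * ennreal (Q x)) * (\<Sum>i. ennreal (\<theta> i) * ennreal (h i x)) \<partial>M)"
    by (rule nn_integral_mono_AE) (use pt in eventually_elim, auto simp: mult.assoc intro!: mult_left_mono)
  also have "\<dots> \<le> (\<integral>\<^sup>+x. u x * ennreal (Q x) \<partial>M)"
    by (rule mean_le) (use hQ in \<open>auto simp: h_def Q_def\<close>)
  finally show "(\<integral>\<^sup>+x. u x * ennreal (infprod (\<lambda>i. g i x powr \<theta> i)) \<partial>M)
        \<le> (\<integral>\<^sup>+x. u x * ennreal (infprod (\<lambda>i. G i x powr \<theta> i)) \<partial>M)"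
    by (simp add: Q_def)
qed

lemma (in prob_space) Hoelder_infprod:
  assumes int: "\<And>i. integrable M (g i)" and g: "\<And>i. AE x in M. 0 \<le> g i x"
    and \<theta>: "\<And>i. 0 \<le> \<theta> i" and sums: "\<theta> sums 1"
    and conv: "prod_converges (\<lambda>i. (\<integral>x. g i x \<partial>M) powr \<theta> i)"
  shows "AE x in M. prod_converges (\<lambda>i. g i x powr \<theta> i)"
    and "(\<integral>\<^sup>+x. ennreal (infprod (\<lambda>i. g i x powr \<theta> i)) \<partial>M)
      \<le> ennreal (infprod (\<lambda>i. (\<integral>x. g i x \<partial>M) powr \<theta> i))"
proof -
  define m where "m i = (\<integral>x. g i x \<partial>M)" for i
  have [measurable]: "\<And>i. g i \<in> borel_measurable M" using int by auto
  have m: "0 \<le> m i" for i unfolding m_def by (rule integral_nonneg_AE) (rule g)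
  have zero: "AE x in M. m i = 0 \<longrightarrow> g i x = 0" for i
    using integral_nonneg_eq_0_iff_AE[OF int g, of i] by (auto simp: m_def)
  have h1: "(\<integral>\<^sup>+x. ennreal (g i x / m i) \<partial>M) \<le> 1" for i
  proof -
    have "(\<integral>\<^sup>+x. ennreal (g i x / m i) \<partial>M) = ennreal (\<integral>x. g i x / m i \<partial>M)"
      using g[of i] by (intro nn_integral_eq_integral integrable_divide int) (auto simp: m)
    also have "\<dots> \<le> 1" by (auto simp: m_def[symmetric])
    finally show ?thesis .
  qed
  have hQ: "(\<integral>\<^sup>+x. 1 * ennreal (infprod (\<lambda>i. m i powr \<theta> i)) * ennreal (g i x / m i) \<partial>M)
      \<le> (\<integral>\<^sup>+x. 1 * ennreal (infprod (\<lambda>i. m i powr \<theta> i)) \<partial>M)" for i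
    using mult_left_mono[OF h1[of i], of "ennreal (infprod (\<lambda>i. m i powr \<theta> i))"]
    by (simp add: nn_integral_cmult emeasure_space_1)
  note H = Hoelder_infprod_normalised[where g=g and G="\<lambda>i _. m i" and u="\<lambda>_. 1" and M=M and \<theta>=\<theta>,
    OF _ _ _ g _ zero \<theta> sums _ h1 hQ]
  show "AE x in M. prod_converges (\<lambda>i. g i x powr \<theta> i)"
    by (rule H(1)) (use m conv in \<open>auto simp: m_def\<close>)
  have "(\<integral>\<^sup>+x. 1 * ennreal (infprod (\<lambda>i. g i x powr \<theta> i)) \<partial>M)
      \<le> (\<integral>\<^sup>+x. 1 * ennreal (infprod (\<lambda>i. m i powr \<theta> i)) \<partial>M)"
    by (rule H(2)) (use m conv in \<open>auto simp: m_def\<close>)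
  then show "(\<integral>\<^sup>+x. ennreal (infprod (\<lambda>i. g i x powr \<theta> i)) \<partial>M)
      \<le> ennreal (infprod (\<lambda>i. (\<integral>x. g i x \<partial>M) powr \<theta> i))"
    by (simp add: emeasure_space_1 m_def)
qed

context sigma_finite_subalgebra
begin

lemma nn_cond_exp_eq_real_cond_exp:
  assumes int: "integrable M g" and g: "AE x in M. 0 \<le> g x"
  shows "AE x in M. nn_cond_exp M F (\<lambda>x. ennreal (g x)) x = ennreal (real_cond_exp M F g x)"
proof -
  have [measurable]: "g \<in> borel_measurable M" using int by auto
  have "AE x in M. nn_cond_exp M F (\<lambda>x. ennreal (- g x)) x = nn_cond_exp M F (\<lambda>_. 0) x"
    by (rule nn_cond_exp_cong) (use g in \<open>auto simp: ennreal_neg\<close>)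
  moreover have "AE x in M. 0 = nn_cond_exp M F (\<lambda>_. 0) x"
    by (rule nn_cond_exp_F_meas) auto
  moreover have "(\<integral>\<^sup>+x. 1 * nn_cond_exp M F (\<lambda>x. ennreal (g x)) x \<partial>M) = (\<integral>\<^sup>+x. 1 * ennreal (g x) \<partial>M)"
    by (rule nn_cond_exp_intg) auto
  then have "(\<integral>\<^sup>+x. nn_cond_exp M F (\<lambda>x. ennreal (g x)) x \<partial>M) \<noteq> \<infinity>"
    using nn_integral_eq_integral[OF int g] by simp
  then have "AE x in M. nn_cond_exp M F (\<lambda>x. ennreal (g x)) x \<noteq> \<infinity>"
    by (intro nn_integral_PInf_AE) auto
  ultimately show ?thesis
    by eventually_elim (simp add: real_cond_exp_def top.not_eq_extremum)
qed

text \<open>The defining property of the conditional expectation, for a nonnegative test function \<open>u\<close> that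
  need not be integrable against \<open>g\<close>. This is what allows division by a conditional expectation
  that has no positive lower bound.\<close>

lemma nn_integral_real_cond_exp:
  assumes int: "integrable M g" and g: "AE x in M. 0 \<le> g x"
    and [measurable]: "u \<in> borel_measurable F"
  shows "(\<integral>\<^sup>+x. u x * ennreal (real_cond_exp M F g x) \<partial>M) = (\<integral>\<^sup>+x. u x * ennreal (g x) \<partial>M)"
proof -
  have [measurable]: "g \<in> borel_measurable M" using int by auto
  have "(\<integral>\<^sup>+x. u x * ennreal (real_cond_exp M F g x) \<partial>M)
      = (\<integral>\<^sup>+x. u x * nn_cond_exp M F (\<lambda>x. ennreal (g x)) x \<partial>M)"
    by (rule nn_integral_cong_AE) (use nn_cond_exp_eq_real_cond_exp[OF int g] in eventually_elim, simp)
  also have "\<dots> = (\<integral>\<^sup>+x. u x * ennreal (g x) \<partial>M)"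
    by (rule nn_cond_exp_intg) auto
  finally show ?thesis .
qed

text \<open>Test the hypothesis with the set on which the claim fails: there the strict inequality of the
  integrands contradicts the inequality of the integrals, which are finite as \<open>X\<close> is integrable.\<close>

lemma AE_le_of_nn_integral_le:
  fixes X Y :: "'a \<Rightarrow> real"
  assumes [measurable]: "X \<in> borel_measurable F" "Y \<in> borel_measurable F"
    and int: "integrable M X" and Y: "AE x in M. 0 \<le> Y x"
    and le: "\<And>B. B \<in> sets F \<Longrightarrow>
      (\<integral>\<^sup>+x. indicator B x * ennreal (X x) \<partial>M) \<le> (\<integral>\<^sup>+x. indicator B x * ennreal (Y x) \<partial>M)"
  shows "AE x in M. X x \<le> Y x"
proof -
  have XM[measurable]: "X \<in> borel_measurable M" "Y \<in> borel_measurable M"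
    by (auto intro: measurable_from_subalg[OF subalg] assms)
  have sp: "space F = space M" using subalg by (simp add: subalgebra_def)
  define B where "B = {x \<in> space M. 0 \<le> Y x \<and> Y x < X x}"
  have B: "B \<in> sets F" unfolding B_def sp[symmetric] by measurable
  then have BM[measurable]: "B \<in> sets M" using subalg by (auto simp: subalgebra_def)
  have "(\<integral>\<^sup>+x. indicator B x * ennreal (X x) \<partial>M) \<le> (\<integral>\<^sup>+x. ennreal (norm (X x)) \<partial>M)"
    by (intro nn_integral_mono) (auto simp: indicator_def intro!: ennreal_leI)
  also have "\<dots> < \<infinity>" using int by (simp add: integrable_iff_bounded)
  finally have finX: "(\<integral>\<^sup>+x. indicator B x * ennreal (X x) \<partial>M) < \<infinity>" .
  have "(\<integral>\<^sup>+x. indicator B x * ennreal (Y x) \<partial>M) \<le> (\<integral>\<^sup>+x. indicator B x * ennreal (X x) \<partial>M)"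
    by (intro nn_integral_mono) (auto simp: B_def indicator_def intro!: ennreal_leI)
  from le_less_trans[OF this finX] have fin: "(\<integral>\<^sup>+x. indicator B x * ennreal (Y x) \<partial>M) \<noteq> \<infinity>"
    by simp
  have "(\<integral>\<^sup>+x. indicator B x * ennreal (X x) - indicator B x * ennreal (Y x) \<partial>M)
      = (\<integral>\<^sup>+x. indicator B x * ennreal (X x) \<partial>M) - (\<integral>\<^sup>+x. indicator B x * ennreal (Y x) \<partial>M)"
    by (rule nn_integral_diff) (use fin in \<open>auto simp: B_def indicator_def intro!: ennreal_leI\<close>)
  also have "\<dots> = 0" using le[OF B] by (simp add: diff_eq_0_iff_ennreal finX[simplified])
  finally have "AE x in M. indicator B x * ennreal (X x) - indicator B x * ennreal (Y x) = 0"
    by (subst (asm) nn_integral_0_iff_AE) auto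
  with Y AE_space show ?thesis
  proof eventually_elim
    case (elim x)
    then have "x \<notin> B"
      by (auto simp: B_def indicator_def ennreal_minus)
    with elim show ?case by (auto simp: B_def)
  qed
qed

lemma real_cond_exp_zero_imp_zero:
  assumes int: "integrable M g" and g: "AE x in M. 0 \<le> g x"
  shows "AE x in M. real_cond_exp M F g x = 0 \<longrightarrow> g x = 0"
proof -
  have [measurable]: "g \<in> borel_measurable M" using int by auto
  define u :: "'a \<Rightarrow> real" where "u x = indicator {0} (real_cond_exp M F g x)" for x
  have u[measurable]: "u \<in> borel_measurable F" unfolding u_def by measurable
  have [measurable]: "u \<in> borel_measurable M" by (rule measurable_from_subalg[OF subalg u])
  have "(\<integral>\<^sup>+x. ennreal (u x) * ennreal (real_cond_exp M F g x) \<partial>M) = 0"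
    by (subst nn_integral_0_iff_AE) (auto simp: u_def indicator_def)
  then have "(\<integral>\<^sup>+x. ennreal (u x) * ennreal (g x) \<partial>M) = 0"
    by (subst (asm) nn_integral_real_cond_exp[OF int g]) auto
  then have "AE x in M. ennreal (u x) * ennreal (g x) = 0"
    by (subst (asm) nn_integral_0_iff_AE) auto
  with g show ?thesis
    by eventually_elim (auto simp: u_def indicator_def ennreal_eq_0_iff)
qed

text \<open>The conditional inequality, stated through integrals over the sets of \<open>F\<close>: in this form
  the infinite products may fail to be integrable. The normalising factors \<open>1 / G i\<close> are
  \<open>F\<close>-measurable and can be moved into the test function, so the conditional expectation of every
  \<open>g i / G i\<close> is at most \<open>1\<close>.\<close>

lemma cond_Hoelder_infprod:
  assumes prob: "prob_space M"
    and int: "\<And>i. integrable M (g i)" and g: "\<And>i. AE x in M. 0 \<le> g i x"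
    and \<theta>: "\<And>i. 0 \<le> \<theta> i" and sums: "\<theta> sums 1"
    and conv: "AE x in M. prod_converges (\<lambda>i. real_cond_exp M F (g i) x powr \<theta> i)"
    and B: "B \<in> sets F"
  shows "AE x in M. prod_converges (\<lambda>i. g i x powr \<theta> i)"
    and "(\<integral>\<^sup>+x. indicator B x * ennreal (infprod (\<lambda>i. g i x powr \<theta> i)) \<partial>M)
      \<le> (\<integral>\<^sup>+x. indicator B x * ennreal (infprod (\<lambda>i. real_cond_exp M F (g i) x powr \<theta> i)) \<partial>M)"
proof -
  define G where "G i = real_cond_exp M F (g i)" for i
  have [measurable]: "\<And>i. g i \<in> borel_measurable M" using int by auto
  have GF[measurable]: "\<And>i. G i \<in> borel_measurable F" "\<And>i. G i \<in> borel_measurable M"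
    unfolding G_def by auto
  have G: "AE x in M. 0 \<le> G i x" for i unfolding G_def by (rule real_cond_exp_pos) (auto intro: g)
  have zero: "AE x in M. G i x = 0 \<longrightarrow> g i x = 0" for i
    unfolding G_def by (rule real_cond_exp_zero_imp_zero[OF int g])
  have [measurable]: "B \<in> sets M" using B subalg by (auto simp: subalgebra_def)
  have h: "(\<integral>\<^sup>+x. w x * ennreal (g i x / G i x) \<partial>M) \<le> (\<integral>\<^sup>+x. w x \<partial>M)"
    if w[measurable]: "w \<in> borel_measurable F" for w i
  proof -
    have [measurable]: "w \<in> borel_measurable M" by (rule measurable_from_subalg[OF subalg w])
    have "(\<integral>\<^sup>+x. w x * ennreal (g i x / G i x) \<partial>M)
        = (\<integral>\<^sup>+x. (w x * ennreal (1 / G i x)) * ennreal (g i x) \<partial>M)"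
      by (rule nn_integral_cong_AE) (use g[of i] G[of i] in eventually_elim,
        simp add: mult.assoc ennreal_mult[symmetric])
    also have "\<dots> = (\<integral>\<^sup>+x. (w x * ennreal (1 / G i x)) * ennreal (G i x) \<partial>M)"
      unfolding G_def[of i] by (rule nn_integral_real_cond_exp[OF int g, symmetric])
        (auto simp flip: G_def)
    also have "\<dots> \<le> (\<integral>\<^sup>+x. w x * 1 \<partial>M)"
    proof (rule nn_integral_mono_AE, use G[of i] in eventually_elim)
      case (elim x)
      then have "ennreal (1 / G i x) * ennreal (G i x) \<le> 1"
        by (simp add: ennreal_mult[symmetric])
      then show ?case unfolding mult.assoc by (rule mult_left_mono) simp
    qed
    finally show ?thesis by simp
  qed
  have h1: "(\<integral>\<^sup>+x. ennreal (g i x / G i x) \<partial>M) \<le> 1" for i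
    using h[of "\<lambda>_. 1" i] prob by (simp add: prob_space.emeasure_space_1)
  have hQ: "(\<integral>\<^sup>+x. indicator B x * ennreal (infprod (\<lambda>i. G i x powr \<theta> i)) * ennreal (g i x / G i x) \<partial>M)
      \<le> (\<integral>\<^sup>+x. indicator B x * ennreal (infprod (\<lambda>i. G i x powr \<theta> i)) \<partial>M)" for i
    by (rule h) (use B in measurable)
  note H = Hoelder_infprod_normalised[where g=g and G=G and u="indicator B" and M=M and \<theta>=\<theta>,
    OF _ _ _ g G zero \<theta> sums _ h1 hQ]
  show "AE x in M. prod_converges (\<lambda>i. g i x powr \<theta> i)"
    by (rule H(1)) (use conv in \<open>auto simp: G_def\<close>)
  show "(\<integral>\<^sup>+x. indicator B x * ennreal (infprod (\<lambda>i. g i x powr \<theta> i)) \<partial>M)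
      \<le> (\<integral>\<^sup>+x. indicator B x * ennreal (infprod (\<lambda>i. real_cond_exp M F (g i) x powr \<theta> i)) \<partial>M)"
    unfolding G_def[symmetric] by (rule H(2)) (use conv in \<open>auto simp: G_def\<close>)
qed

text \<open>The unconditional inequality applied to the functions \<open>real_cond_exp M F (g i)\<close>, which have the
  same integrals as the \<open>g i\<close>. It supplies the convergence hypothesis of the conditional inequality.\<close>

lemma Hoelder_infprod_of_real_cond_exp:
  assumes prob: "prob_space M"
    and int: "\<And>i. integrable M (g i)" and g: "\<And>i. AE x in M. 0 \<le> g i x"
    and \<theta>: "\<And>i. 0 \<le> \<theta> i" and sums: "\<theta> sums 1"
    and conv: "prod_converges (\<lambda>i. (\<integral>x. g i x \<partial>M) powr \<theta> i)"
  shows "AE x in M. prod_converges (\<lambda>i. real_cond_exp M F (g i) x powr \<theta> i)"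
    and "(\<integral>\<^sup>+x. ennreal (infprod (\<lambda>i. real_cond_exp M F (g i) x powr \<theta> i)) \<partial>M)
      \<le> ennreal (infprod (\<lambda>i. (\<integral>x. g i x \<partial>M) powr \<theta> i))"
proof -
  have eq: "(\<integral>x. real_cond_exp M F (g i) x \<partial>M) = (\<integral>x. g i x \<partial>M)" for i
    by (rule real_cond_exp_int(2)[OF int])
  note H = prob_space.Hoelder_infprod[OF prob, where g="\<lambda>i. real_cond_exp M F (g i)" and \<theta>=\<theta>, unfolded eq,
    OF _ _ \<theta> sums conv]
  have 1: "integrable M (real_cond_exp M F (g i))" for i by (rule real_cond_exp_int(1)[OF int])
  have 2: "AE x in M. 0 \<le> real_cond_exp M F (g i) x" for i
    by (rule real_cond_exp_pos) (use g int in auto)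
  show "AE x in M. prod_converges (\<lambda>i. real_cond_exp M F (g i) x powr \<theta> i)"
    "(\<integral>\<^sup>+x. ennreal (infprod (\<lambda>i. real_cond_exp M F (g i) x powr \<theta> i)) \<partial>M)
      \<le> ennreal (infprod (\<lambda>i. (\<integral>x. g i x \<partial>M) powr \<theta> i))"
    using H[OF 1 2] by auto
qed

end

section \<open>Dual weights\<close>

lemma inverse_conj_exp: "1 < r \<Longrightarrow> 1 / conj_exp r = 1 - 1 / r"
  using conj_exp_eq[of r] by linarith

lemma dual_weight_factorisation:
  assumes r: "1 < r" and w: "0 < w x" and y: "0 \<le> y"
  shows "(y powr r * w x) powr (1 / r) * dual_weight r w x powr (1 / conj_exp r) = y"
proof (cases "y = 0")
  case False
  have "(y powr r * w x) powr (1 / r) * dual_weight r w x powr (1 / conj_exp r)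
      = y powr (r * (1 / r)) * (w x powr (1 / r) * w x powr (- 1 / (r - 1) * (1 / conj_exp r)))"
    using w y by (simp add: powr_mult powr_powr dual_weight_def)
  also have "\<dots> = y powr (r * (1 / r)) * w x powr (1 / r + - 1 / (r - 1) * (1 / conj_exp r))"
    by (simp only: powr_add)
  also have "1 / r + - 1 / (r - 1) * (1 / conj_exp r) = 0"
    using r by (simp add: inverse_conj_exp field_simps)
  finally show ?thesis using r w y False by simp
qed (use r in simp)

lemma dual_weight_powr_times_weight:
  assumes r: "1 < r" and w: "0 < w x"
  shows "dual_weight r w x powr r * w x = dual_weight r w x"
proof -
  have "dual_weight r w x powr r * w x = w x powr (- 1 / (r - 1) * r) * w x powr 1"
    using w by (simp add: dual_weight_def powr_powr)
  also have "\<dots> = w x powr (- 1 / (r - 1) * r + 1)" by (simp only: powr_add)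
  also have "- 1 / (r - 1) * r + 1 = - 1 / (r - 1)" using r by (simp add: field_simps)
  finally show ?thesis by (simp add: dual_weight_def)
qed

lemma dual_weight_nonneg: "0 \<le> dual_weight r w x"
  by (simp add: dual_weight_def)

text \<open>Both factors of \<open>\<bar>f\<bar>\<close> in the factorisation above are bounded by powers of the sum
  \<open>\<bar>f\<bar>\<^sup>r w + \<sigma>\<close>, and the exponents add up to \<open>1\<close>.\<close>

lemma in_Lq_integrable:
  assumes r: "1 < r" and w: "weight M w" and f: "in_Lq M r w f"
    and \<sigma>: "integrable M (dual_weight r w)"
  shows "integrable M f"
proof (rule Bochner_Integration.integrable_bound)
  show "integrable M (\<lambda>x. \<bar>f x\<bar> powr r * w x + dual_weight r w x)"
    using f \<sigma> by (auto simp: in_Lq_def)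
  show "f \<in> borel_measurable M" using f by (simp add: in_Lq_def)
  have "AE x in M. 0 < w x" using w by (simp add: weight_def)
  then show "AE x in M. norm (f x) \<le> norm (\<bar>f x\<bar> powr r * w x + dual_weight r w x)"
  proof eventually_elim
    case (elim x)
    let ?a = "\<bar>f x\<bar> powr r * w x" and ?s = "dual_weight r w x"
    have nn: "0 \<le> ?a" "0 \<le> ?s" using elim by (simp_all add: dual_weight_nonneg)
    have "norm (f x) = ?a powr (1 / r) * ?s powr (1 / conj_exp r)"
      using dual_weight_factorisation[where w=w and x=x and y="\<bar>f x\<bar>", OF r elim] by simp
    also have "\<dots> \<le> (?a + ?s) powr (1 / r) * (?a + ?s) powr (1 / conj_exp r)"
      using r nn by (intro mult_mono powr_mono2) (auto simp: inverse_conj_exp)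
    also have "\<dots> = ?a + ?s" using r nn by (simp add: powr_add[symmetric] inverse_conj_exp)
    finally show ?case using nn by simp
  qed
qed

text \<open>The conditional inequality for two functions: pad the pair \<open>f\<^sup>r w\<close>, \<open>\<sigma>\<close> with constants \<open>1\<close> of
  exponent \<open>0\<close>.\<close>

lemma (in sigma_finite_subalgebra) cond_Hoelder_dual_weight:
  assumes prob: "prob_space M" and r: "1 < r" and w: "weight M w"
    and f: "in_Lq M r w f" "AE x in M. 0 \<le> f x" and \<sigma>: "integrable M (dual_weight r w)"
  shows "AE x in M. real_cond_exp M F f x
    \<le> real_cond_exp M F (\<lambda>y. \<bar>f y\<bar> powr r * w y) x powr (1 / r)
      * real_cond_exp M F (dual_weight r w) x powr (1 / conj_exp r)"
proof -
  let ?a = "\<lambda>y. \<bar>f y\<bar> powr r * w y" and ?\<sigma> = "dual_weight r w"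
  let ?Y = "\<lambda>x. real_cond_exp M F ?a x powr (1 / r) * real_cond_exp M F ?\<sigma> x powr (1 / conj_exp r)"
  have wpos: "AE x in M. 0 < w x" using w by (simp add: weight_def)
  have inta: "integrable M ?a" using f by (simp add: in_Lq_def)
  have intf: "integrable M f" by (rule in_Lq_integrable[OF r w f(1) \<sigma>])
  define g :: "nat \<Rightarrow> 'a \<Rightarrow> real" where "g i = (if i = 0 then ?a else if i = 1 then ?\<sigma> else (\<lambda>_. 1))" for i
  define \<theta> :: "nat \<Rightarrow> real" where "\<theta> i = (if i = 0 then 1 / r else if i = 1 then 1 / conj_exp r else 0)" for i
  interpret P: prob_space M by (rule prob)
  have int: "integrable M (g i)" for i using inta \<sigma> by (simp add: g_def)
  have nn: "AE x in M. 0 \<le> g i x" for i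
    using wpos by eventually_elim (simp add: g_def dual_weight_nonneg)
  have \<theta>: "0 \<le> \<theta> i" for i using r by (simp add: \<theta>_def inverse_conj_exp)
  have "\<theta> sums (\<Sum>i\<in>{0,1}. \<theta> i)" by (rule sums_finite) (auto simp: \<theta>_def)
  then have sums: "\<theta> sums 1" using r by (simp add: \<theta>_def inverse_conj_exp)
  have "AE x in M. real_cond_exp M F (\<lambda>_. 1) x = (1::real)" by (rule real_cond_exp_F_meas) auto
  then have G: "AE x in M. prod_converges (\<lambda>i. real_cond_exp M F (g i) x powr \<theta> i)
      \<and> infprod (\<lambda>i. real_cond_exp M F (g i) x powr \<theta> i) = ?Y x"
  proof eventually_elim
    case (elim x)
    have "real_cond_exp M F (g i) x powr \<theta> i = 1" if "2 \<le> i" for i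
      using that elim by (simp add: g_def)
    from infprod_two_factors[of "\<lambda>i. real_cond_exp M F (g i) x powr \<theta> i", OF this]
    show ?case by (simp add: g_def \<theta>_def)
  qed
  have S: "AE x in M. infprod (\<lambda>i. g i x powr \<theta> i) = f x"
    using wpos f(2)
  proof eventually_elim
    case (elim x)
    have "g i x powr \<theta> i = 1" if "2 \<le> i" for i using that by (simp add: g_def)
    from infprod_two_factors(2)[of "\<lambda>i. g i x powr \<theta> i", OF this]
    show ?case using dual_weight_factorisation[where w=w and x=x, OF r elim] elim(2) by (simp add: g_def \<theta>_def)
  qed
  show ?thesis
  proof (rule AE_le_of_nn_integral_le)
    show "integrable M (real_cond_exp M F f)" by (rule real_cond_exp_int(1)[OF intf])
    fix B assume B: "B \<in> sets F"
    have "(\<integral>\<^sup>+x. indicator B x * ennreal (real_cond_exp M F f x) \<partial>M)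
        = (\<integral>\<^sup>+x. indicator B x * ennreal (f x) \<partial>M)"
      by (rule nn_integral_real_cond_exp[OF intf f(2)]) (use B in measurable)
    also have "\<dots> = (\<integral>\<^sup>+x. indicator B x * ennreal (infprod (\<lambda>i. g i x powr \<theta> i)) \<partial>M)"
      by (rule nn_integral_cong_AE) (use S in eventually_elim, simp)
    also have "\<dots> \<le> (\<integral>\<^sup>+x. indicator B x * ennreal (infprod (\<lambda>i. real_cond_exp M F (g i) x powr \<theta> i)) \<partial>M)"
      by (rule cond_Hoelder_infprod(2)[OF prob int nn \<theta> sums _ B]) (use G in auto)
    also have "\<dots> = (\<integral>\<^sup>+x. indicator B x * ennreal (?Y x) \<partial>M)"
      by (rule nn_integral_cong_AE) (use G in eventually_elim, simp)
    finally show "(\<integral>\<^sup>+x. indicator B x * ennreal (real_cond_exp M F f x) \<partial>M)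
        \<le> (\<integral>\<^sup>+x. indicator B x * ennreal (?Y x) \<partial>M)" .
  qed auto
qed

section \<open>Products of conditional expectations of test sequences\<close>

locale dual_weights = prob_space M
  for M :: "'a measure" +
  fixes p :: real and ps :: "nat \<Rightarrow> real" and \<omega> :: "nat \<Rightarrow> 'a \<Rightarrow> real"
  assumes ps: "\<And>i. 1 < ps i" and p: "0 < p" and sum_ps: "(\<lambda>i. 1 / ps i) sums (1 / p)"
    and weight_\<omega>: "\<And>i. weight M (\<omega> i)"
    and \<sigma>_int: "\<And>i. integrable M (dual_weight (ps i) (\<omega> i))"
begin

abbreviation \<sigma> :: "nat \<Rightarrow> 'a \<Rightarrow> real" where "\<sigma> i \<equiv> dual_weight (ps i) (\<omega> i)"

text \<open>The function whose integral is the \<open>ps i\<close>-th power of the weighted norm of \<open>f i\<close>.\<close>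

abbreviation mass :: "(nat \<Rightarrow> 'a \<Rightarrow> real) \<Rightarrow> nat \<Rightarrow> 'a \<Rightarrow> real" where
  "mass f i \<equiv> \<lambda>x. \<bar>f i x\<bar> powr ps i * \<omega> i x"

abbreviation norm_product :: "(nat \<Rightarrow> 'a \<Rightarrow> real) \<Rightarrow> real" where
  "norm_product f \<equiv> infprod (\<lambda>i. Lq_norm M (ps i) (\<omega> i) (f i))"

lemma \<omega>_pos: "AE x in M. \<forall>i. 0 < \<omega> i x"
  using weight_\<omega> by (simp add: weight_def AE_all_countable)

lemma exponents: "0 \<le> p / ps i" "(\<lambda>i. p / ps i) sums 1"
proof -
  show "0 \<le> p / ps i" using ps[of i] p by simp
  show "(\<lambda>i. p / ps i) sums 1" using sums_mult[OF sum_ps, of p] p by simp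
qed

lemma sigma_finite_subalgebraI:
  assumes "subalgebra M G"
  shows "sigma_finite_subalgebra M G"
proof -
  interpret G: finite_measure_subalgebra M G by unfold_locales (rule assms)
  show ?thesis by (rule G.sigma_finite_subalgebra_axioms)
qed

lemma test_sequenceD:
  assumes "test_sequence M ps \<omega> f"
  shows "in_Lq M (ps i) (\<omega> i) (f i)" "AE x in M. 0 \<le> f i x" "integrable M (f i)"
    "integrable M (mass f i)" "AE x in M. 0 \<le> mass f i x"
proof -
  show 1: "in_Lq M (ps i) (\<omega> i) (f i)" "AE x in M. 0 \<le> f i x"
    using assms by (auto simp: test_sequence_def)
  show "integrable M (f i)" by (rule in_Lq_integrable[OF ps weight_\<omega> 1(1) \<sigma>_int])
  show "integrable M (mass f i)" using 1(1) by (simp add: in_Lq_def)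
  show "AE x in M. 0 \<le> mass f i x" using \<omega>_pos by eventually_elim (simp add: less_imp_le)
qed

lemma norm_product_powr:
  assumes "prod_converges (\<lambda>i. Lq_norm M (ps i) (\<omega> i) (f i))"
  shows "prod_converges (\<lambda>i. (\<integral>x. mass f i x \<partial>M) powr (p / ps i))"
    "infprod (\<lambda>i. (\<integral>x. mass f i x \<partial>M) powr (p / ps i)) = norm_product f powr p"
    "0 \<le> norm_product f"
proof -
  have "(\<lambda>i. Lq_norm M (ps i) (\<omega> i) (f i) powr p) = (\<lambda>i. (\<integral>x. mass f i x \<partial>M) powr (p / ps i))"
    by (simp add: Lq_norm_def powr_powr)
  with infprod_powr[OF assms _ p] show "prod_converges (\<lambda>i. (\<integral>x. mass f i x \<partial>M) powr (p / ps i))"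
    "infprod (\<lambda>i. (\<integral>x. mass f i x \<partial>M) powr (p / ps i)) = norm_product f powr p"
    by (simp_all add: Lq_norm_def)
  show "0 \<le> norm_product f" by (rule infprod_nonneg[OF assms]) (simp add: Lq_norm_def)
qed

text \<open>The exponents \<open>p / ps i\<close> add up to \<open>1\<close>, so Hoelder's inequality applies to the masses. A finite
  product of norms is exactly what makes the product of the powers of their integrals converge.\<close>

lemma cond_mass_product:
  assumes G: "subalgebra M G" and f: "test_sequence M ps \<omega> f"
  shows "AE x in M. prod_converges (\<lambda>i. real_cond_exp M G (mass f i) x powr (1 / ps i))"
    and "(\<integral>\<^sup>+x. ennreal (infprod (\<lambda>i. real_cond_exp M G (mass f i) x powr (p / ps i))) \<partial>M)
      \<le> ennreal (norm_product f powr p)"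
proof -
  interpret G: sigma_finite_subalgebra M G by (rule sigma_finite_subalgebraI[OF G])
  have c: "prod_converges (\<lambda>i. Lq_norm M (ps i) (\<omega> i) (f i))"
    using f by (simp add: test_sequence_def)
  note H = G.Hoelder_infprod_of_real_cond_exp[where g="mass f", OF prob_space_axioms
    test_sequenceD(4,5)[OF f] exponents norm_product_powr(1)[OF c], unfolded norm_product_powr(2)[OF c]]
  show "(\<integral>\<^sup>+x. ennreal (infprod (\<lambda>i. real_cond_exp M G (mass f i) x powr (p / ps i))) \<partial>M)
      \<le> ennreal (norm_product f powr p)" by (rule H(2))
  show "AE x in M. prod_converges (\<lambda>i. real_cond_exp M G (mass f i) x powr (1 / ps i))"
    using H(1)
  proof eventually_elim
    case (elim x)
    from infprod_powr(1)[OF elim, of "1 / p"] p show ?case by (simp add: powr_powr)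
  qed
qed

text \<open>The conditional inequality for two functions bounds each factor by the product of a power of the
  conditional mass and a power of the conditional dual weight. By comparison, the products of
  conditional expectations converge wherever those of the dual weights do.\<close>

lemma cond_product_bound:
  assumes G: "subalgebra M G" and f: "test_sequence M ps \<omega> f"
  shows "AE x in M. (\<forall>i. 0 \<le> real_cond_exp M G (f i) x) \<and>
      (prod_converges (\<lambda>i. real_cond_exp M G (\<sigma> i) x powr (1 / conj_exp (ps i))) \<longrightarrow>
        prod_converges (\<lambda>i. real_cond_exp M G (f i) x) \<and>
        infprod (\<lambda>i. real_cond_exp M G (f i) x) powr p
          \<le> infprod (\<lambda>i. real_cond_exp M G (mass f i) x powr (p / ps i))
            * infprod (\<lambda>i. real_cond_exp M G (\<sigma> i) x powr (1 / conj_exp (ps i))) powr p)"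
proof -
  interpret G: sigma_finite_subalgebra M G by (rule sigma_finite_subalgebraI[OF G])
  have "AE x in M. \<forall>i. real_cond_exp M G (f i) x
    \<le> real_cond_exp M G (mass f i) x powr (1 / ps i)
      * real_cond_exp M G (\<sigma> i) x powr (1 / conj_exp (ps i))"
    unfolding AE_all_countable
    by (intro allI G.cond_Hoelder_dual_weight[OF prob_space_axioms ps weight_\<omega> test_sequenceD(1,2)[OF f] \<sigma>_int])
  moreover have "AE x in M. \<forall>i. 0 \<le> real_cond_exp M G (f i) x"
    unfolding AE_all_countable
    by (intro allI G.real_cond_exp_pos test_sequenceD(2)[OF f]) (use test_sequenceD(3)[OF f] in auto)
  ultimately show ?thesis using cond_mass_product(1)[OF G f]
  proof eventually_elim
    case (elim x)
    let ?e = "\<lambda>i. real_cond_exp M G (f i) x"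
    let ?a = "\<lambda>i. real_cond_exp M G (mass f i) x powr (1 / ps i)"
    let ?s = "\<lambda>i. real_cond_exp M G (\<sigma> i) x powr (1 / conj_exp (ps i))"
    have a: "prod_converges ?a" "\<And>i. 0 \<le> ?a i" using elim by auto
    have "infprod (\<lambda>i. real_cond_exp M G (mass f i) x powr (p / ps i)) = infprod ?a powr p"
      using infprod_powr(2)[OF a p] by (simp add: powr_powr)
    moreover {
      assume s: "prod_converges ?s"
      note as = infprod_mult[OF a(1) s]
      have e: "prod_converges ?e" by (rule prod_converges_comparison[OF as(1)]) (use elim in auto)
      have "infprod ?e \<le> infprod ?a * infprod ?s"
        unfolding as(2)[symmetric] by (rule infprod_mono[OF e as(1)]) (use elim in auto)
      then have "infprod ?e powr p \<le> (infprod ?a * infprod ?s) powr p"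
        using p infprod_nonneg[OF e] elim by (intro powr_mono2) auto
      also have "\<dots> = infprod ?a powr p * infprod ?s powr p"
        by (rule powr_mult)
      finally have "prod_converges ?e" "infprod ?e powr p \<le> infprod ?a powr p * infprod ?s powr p"
        using e by auto }
    ultimately show ?case using elim by auto
  qed
qed

end

section \<open>Stopping times\<close>

locale filtered_prob_space = prob_space M
  for M :: "'a measure" +
  fixes F :: "nat \<Rightarrow> 'a measure"
  assumes filt: "filtration (space M) F" and sub: "\<And>n. subalgebra M (F n)"
begin

lemma space_F: "space (F n) = space M"
  using sub by (simp add: subalgebra_def)

lemma sets_F_mono: "m \<le> n \<Longrightarrow> A \<in> sets (F m) \<Longrightarrow> A \<in> sets (F n)"
  using filtration.sets_F_mono[OF filt, of m n] by auto

lemma sets_F: "A \<in> sets (F n) \<Longrightarrow> A \<in> sets M"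
  using sub[of n] by (auto simp: subalgebra_def)

lemma sets_stopped_algebra:
  assumes \<tau>: "ext_stopping_time M F \<tau>"
  shows "sets (stopped_algebra M F \<tau>)
    = {A \<in> sets M. \<forall>n. A \<inter> {x \<in> space M. \<tau> x \<le> enat n} \<in> sets (F n)}" (is "_ = ?S")
proof -
  have le: "{x \<in> space M. \<tau> x \<le> enat n} \<in> sets (F n)" for n
    using \<tau> by (simp add: ext_stopping_time_def)
  have "sigma_algebra (space M) ?S"
    unfolding sigma_algebra_iff2
  proof (intro conjI ballI allI impI)
    show "?S \<subseteq> Pow (space M)" using sets.sets_into_space by auto
    fix A assume A: "A \<in> ?S"
    have "(space M - A) \<inter> {x \<in> space M. \<tau> x \<le> enat n}
        = {x \<in> space M. \<tau> x \<le> enat n} - A \<inter> {x \<in> space M. \<tau> x \<le> enat n}" for n by auto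
    with A le show "space M - A \<in> ?S" by auto
  next
    fix A :: "nat \<Rightarrow> 'a set" assume A: "range A \<subseteq> ?S"
    have "(\<Union>i. A i) \<inter> {x \<in> space M. \<tau> x \<le> enat n} = (\<Union>i. A i \<inter> {x \<in> space M. \<tau> x \<le> enat n})" for n
      by auto
    moreover have "A i \<in> sets M" "A i \<inter> {x \<in> space M. \<tau> x \<le> enat n} \<in> sets (F n)" for i n
      using A by auto
    ultimately show "(\<Union>i. A i) \<in> ?S" by (auto simp del: UN_simps)
  qed auto
  then show ?thesis unfolding stopped_algebra_def by (rule sigma_algebra.sets_measure_of_eq)
qed

lemma subalgebra_stopped_algebra:
  assumes "ext_stopping_time M F \<tau>"
  shows "subalgebra M (stopped_algebra M F \<tau>)"
  unfolding subalgebra_def sets_stopped_algebra[OF assms] by (auto simp: stopped_algebra_def space_measure_of_conv)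

lemma stopping_time_eq_sets:
  assumes "ext_stopping_time M F \<tau>"
  shows "{x \<in> space M. \<tau> x = enat n} \<in> sets (F n)"
proof -
  have le: "{x \<in> space M. \<tau> x \<le> enat n} \<in> sets (F n)" for n
    using assms by (simp add: ext_stopping_time_def)
  show ?thesis
  proof (cases n)
    case 0
    with le[of 0] show ?thesis by (simp add: zero_enat_def[symmetric])
  next
    case (Suc m)
    have "{x \<in> space M. \<tau> x = enat (Suc m)} = {x \<in> space M. \<tau> x \<le> enat (Suc m)} - {x \<in> space M. \<tau> x \<le> enat m}"
    proof -
      have "\<tau> x = enat (Suc m) \<longleftrightarrow> \<tau> x \<le> enat (Suc m) \<and> \<not> \<tau> x \<le> enat m" for x
        by (cases "\<tau> x") auto
      then show ?thesis by auto
    qed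
    with le[of "Suc m"] sets_F_mono[OF _ le[of m], of "Suc m"] Suc show ?thesis by auto
  qed
qed

text \<open>Intersecting the set with the event \<open>\<tau> \<le> m\<close> leaves it unchanged if \<open>n \<le> m\<close> and empties it
  otherwise.\<close>

lemma stopped_algebra_trace:
  assumes \<tau>: "ext_stopping_time M F \<tau>" and A: "A \<in> sets (F n)"
  shows "A \<inter> {x \<in> space M. \<tau> x = enat n} \<in> sets (stopped_algebra M F \<tau>)"
proof -
  have D: "A \<inter> {x \<in> space M. \<tau> x = enat n} \<in> sets (F n)"
    using A stopping_time_eq_sets[OF \<tau>, of n] by auto
  have "A \<inter> {x \<in> space M. \<tau> x = enat n} \<inter> {x \<in> space M. \<tau> x \<le> enat m}
      = (if n \<le> m then A \<inter> {x \<in> space M. \<tau> x = enat n} else {})" for m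
    by auto
  then show ?thesis
    unfolding sets_stopped_algebra[OF \<tau>] using D sets_F[OF D] sets_F_mono[OF _ D] by auto
qed

lemma finite_event_eq_UN: "finite_event M \<tau> = (\<Union>n. {x \<in> space M. \<tau> x = enat n})"
  by (auto simp: finite_event_def)

lemma finite_event_stopped:
  assumes "ext_stopping_time M F \<tau>"
  shows "finite_event M \<tau> \<in> sets (stopped_algebra M F \<tau>)"
  unfolding finite_event_eq_UN
  using stopped_algebra_trace[OF assms sets.top] by (auto simp: space_F Int_def cong: conj_cong)

text \<open>On the event \<open>D\<close> that \<open>\<tau>\<close> equals \<open>n\<close>, the stopped algebra and \<open>F n\<close> contain the same sets. So
  \<open>real_cond_exp M (F n) f\<close> cut off to \<open>D\<close> is measurable for the stopped algebra, and over its sets it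
  has the same integrals as \<open>f\<close> cut off to \<open>D\<close>.\<close>

lemma real_cond_exp_stopped_algebra:
  assumes \<tau>: "ext_stopping_time M F \<tau>" and int: "integrable M f"
  shows "AE x in M. \<forall>n. \<tau> x = enat n \<longrightarrow>
    real_cond_exp M (stopped_algebra M F \<tau>) f x = real_cond_exp M (F n) f x"
  unfolding AE_all_countable
proof
  fix n
  let ?T = "stopped_algebra M F \<tau>"
  define D where "D = {x \<in> space M. \<tau> x = enat n}"
  note subT = subalgebra_stopped_algebra[OF \<tau>]
  interpret T: finite_measure_subalgebra M ?T by unfold_locales (rule subT)
  interpret Fn: finite_measure_subalgebra M "F n" by unfold_locales (rule sub)
  have [measurable]: "f \<in> borel_measurable M" using int by auto
  have DF: "D \<in> sets (F n)" unfolding D_def by (rule stopping_time_eq_sets[OF \<tau>])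
  have DM[measurable]: "D \<in> sets M" by (rule sets_F[OF DF])
  have DT: "D \<in> sets ?T"
    using stopped_algebra_trace[OF \<tau> sets.top, of n] by (simp add: D_def space_F Int_def cong: conj_cong)
  define h where "h = real_cond_exp M (F n) f"
  have hF[measurable]: "h \<in> borel_measurable (F n)" "h \<in> borel_measurable M" by (auto simp: h_def)
  have inth: "integrable M h" unfolding h_def by (rule Fn.real_cond_exp_int(1)[OF int])
  have int_D: "integrable M (\<lambda>x. indicator D x * g x)" if "integrable M g" for g :: "'a \<Rightarrow> real"
    using integrable_mult_indicator[OF DM that] by simp
  have "AE x in M. real_cond_exp M ?T (\<lambda>x. indicator D x * f x) x = indicator D x * h x"
  proof (rule T.real_cond_exp_charact)
    fix A assume A: "A \<in> sets ?T"
    then have "A \<inter> {x \<in> space M. \<tau> x \<le> enat n} \<in> sets (F n)"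
      by (simp add: sets_stopped_algebra[OF \<tau>])
    from sets.Int[OF this DF] have AD: "A \<inter> D \<in> sets (F n)"
      by (simp add: D_def Int_def conj_ac cong: conj_cong)
    have "(LINT x:A|M. indicator D x * f x) = (LINT x:A \<inter> D|M. f x)"
      by (simp add: set_lebesgue_integral_def indicator_inter_arith mult.assoc)
    also have "\<dots> = (LINT x:A \<inter> D|M. h x)"
      unfolding h_def by (rule Fn.real_cond_exp_intA[OF int AD])
    also have "\<dots> = (LINT x:A|M. indicator D x * h x)"
      by (simp add: set_lebesgue_integral_def indicator_inter_arith mult.assoc)
    finally show "(LINT x:A|M. indicator D x * f x) = (LINT x:A|M. indicator D x * h x)" .
  next
    show "(\<lambda>x. indicator D x * h x) \<in> borel_measurable ?T"
    proof (rule measurableI)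
      fix U :: "real set" assume U: "U \<in> sets borel"
      have "h -` U \<inter> space (F n) \<in> sets (F n)" by (rule measurable_sets[OF hF(1) U])
      from stopped_algebra_trace[OF \<tau> this]
      have 1: "(h -` U \<inter> space M) \<inter> D \<in> sets ?T" by (simp add: D_def space_F)
      have "(\<lambda>x. indicator D x * h x) -` U \<inter> space ?T
          = (h -` U \<inter> space M) \<inter> D \<union> (if 0 \<in> U then space ?T - D else {})"
        using subT by (auto simp: subalgebra_def indicator_def of_bool_def split: if_splits)
      also have "\<dots> \<in> sets ?T" using 1 DT by auto
      finally show "(\<lambda>x. indicator D x * h x) -` U \<inter> space ?T \<in> sets ?T" .
    qed simp
  qed (auto intro: int_D int inth)
  moreover have "AE x in M. real_cond_exp M ?T (\<lambda>x. indicator D x * f x) x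
      = indicator D x * real_cond_exp M ?T f x"
    by (rule T.real_cond_exp_mult) (use DT int_D[OF int] in auto)
  ultimately show "AE x in M. \<tau> x = enat n \<longrightarrow>
      real_cond_exp M ?T f x = real_cond_exp M (F n) f x"
    using AE_space by eventually_elim (auto simp: D_def h_def)
qed

end

section \<open>Powers in the extended half-line\<close>

lemma ennreal_powr_le_iff:
  assumes p: "0 < p" and b: "0 \<le> b"
  shows "ennreal_powr X (1 / p) \<le> ennreal b \<longleftrightarrow> X \<le> ennreal (b powr p)"
proof (cases X)
  case (real r)
  have "r powr (1 / p) \<le> b \<longleftrightarrow> r \<le> b powr p"
  proof
    assume "r powr (1 / p) \<le> b"
    from powr_mono2[OF _ _ this, of p] show "r \<le> b powr p" using p real by (simp add: powr_powr)
  next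
    assume "r \<le> b powr p"
    from powr_mono2[OF _ _ this, of "1 / p"] show "r powr (1 / p) \<le> b"
      using p b real by (simp add: powr_powr)
  qed
  with real b show ?thesis by (simp add: ennreal_powr_def)
qed (simp add: ennreal_powr_def top_unique)

lemma ennreal_mult_powr:
  assumes p: "0 < p" and t: "0 < t"
  shows "ennreal t * ennreal_powr X (1 / p) = ennreal_powr (ennreal (t powr p) * X) (1 / p)"
proof (cases X)
  case (real r)
  have "ennreal (t powr p) * X = ennreal (t powr p * r)" using real by (simp add: ennreal_mult)
  then show ?thesis using real p t
    by (simp add: ennreal_powr_def powr_mult powr_powr ennreal_mult[symmetric])
next
  case top
  with t show ?thesis by (simp add: ennreal_powr_def ennreal_mult_top)
qed

section \<open>The stopped inequality, the weak-type inequality and the \<open>A\<close> condition\<close>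

locale weighted_filtration = dual_weights M p ps \<omega> + filtered_prob_space M F
  for M :: "'a measure" and p ps \<omega> F +
  fixes v :: "'a \<Rightarrow> real"
  assumes weight_v: "weight M v"
    and dual_conv: "\<And>n. AE x in M. prod_converges (\<lambda>i.
      real_cond_exp M (F n) (dual_weight (ps i) (\<omega> i)) x powr (1 / conj_exp (ps i)))"
begin

lemma v: "integrable M v" "AE x in M. 0 \<le> v x" "v \<in> borel_measurable M"
  using weight_v by (auto simp: weight_def)

lemma dual_conv_stopped:
  assumes \<tau>: "ext_stopping_time M F \<tau>"
  shows "AE x in M. x \<in> finite_event M \<tau> \<longrightarrow> prod_converges (\<lambda>i.
    real_cond_exp M (stopped_algebra M F \<tau>) (\<sigma> i) x powr (1 / conj_exp (ps i)))"
proof -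
  have "AE x in M. \<forall>i n. \<tau> x = enat n \<longrightarrow>
      real_cond_exp M (stopped_algebra M F \<tau>) (\<sigma> i) x = real_cond_exp M (F n) (\<sigma> i) x"
    by (subst AE_all_countable) (intro allI real_cond_exp_stopped_algebra[OF \<tau> \<sigma>_int])
  moreover have "AE x in M. \<forall>n. prod_converges (\<lambda>i.
      real_cond_exp M (F n) (\<sigma> i) x powr (1 / conj_exp (ps i)))"
    using dual_conv by (simp add: AE_all_countable)
  ultimately show ?thesis
    by eventually_elim (auto simp: finite_event_def)
qed

text \<open>The \<open>A\<close> condition carries over from the times \<open>n\<close> to \<open>\<tau>\<close> and cancels the contribution of the dual
  weights in the bound for products of conditional expectations. After \<open>v\<close> is replaced by its
  conditional expectation, only the product of powers of the conditional masses is left, and its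
  integral is at most the \<open>p\<close>-th power of the product of the norms.\<close>

lemma stopped_bound_of_A_condition:
  assumes A: "AE x in M. \<forall>n. real_cond_exp M (F n) v x powr (1 / p) *
      infprod (\<lambda>i. real_cond_exp M (F n) (\<sigma> i) x powr (1 / conj_exp (ps i))) \<le> C"
    and C: "0 < C" and \<tau>: "ext_stopping_time M F \<tau>" and f: "test_sequence M ps \<omega> f"
  shows "ennreal_powr (\<integral>\<^sup>+x\<in>finite_event M \<tau>.
      ennreal (infprod (\<lambda>i. real_cond_exp M (stopped_algebra M F \<tau>) (f i) x powr p))
      * ennreal (v x) \<partial>M) (1 / p) \<le> ennreal (C * norm_product f)"
proof -
  let ?T = "stopped_algebra M F \<tau>"
  let ?E = "real_cond_exp M ?T"
  let ?D = "finite_event M \<tau>"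
  note subT = subalgebra_stopped_algebra[OF \<tau>]
  interpret T: sigma_finite_subalgebra M ?T by (rule sigma_finite_subalgebraI[OF subT])
  have DT[measurable]: "?D \<in> sets ?T" by (rule finite_event_stopped[OF \<tau>])
  define S where "S x = infprod (\<lambda>i. ?E (mass f i) x powr (p / ps i))" for x
  have [measurable]: "S \<in> borel_measurable M" unfolding S_def by measurable
  have N: "0 \<le> norm_product f" using f by (intro norm_product_powr(3)) (simp add: test_sequence_def)
  have "AE x in M. \<forall>i n. \<tau> x = enat n \<longrightarrow> ?E (\<sigma> i) x = real_cond_exp M (F n) (\<sigma> i) x"
    by (subst AE_all_countable) (intro allI real_cond_exp_stopped_algebra[OF \<tau> \<sigma>_int])
  moreover have "AE x in M. 0 \<le> ?E v x" by (rule T.real_cond_exp_pos) (auto intro: v)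
  ultimately have ptw: "AE x in M. x \<in> ?D \<longrightarrow>
      ennreal (infprod (\<lambda>i. ?E (f i) x powr p)) * ennreal (?E v x) \<le> ennreal (C powr p) * ennreal (S x)"
    using A real_cond_exp_stopped_algebra[OF \<tau> v(1)] cond_product_bound[OF subT f] dual_conv_stopped[OF \<tau>]
      cond_mass_product(1)[OF subT f]
  proof eventually_elim
    case (elim x)
    show ?case
    proof
      assume xD: "x \<in> ?D"
      then obtain n where n: "\<tau> x = enat n" by (auto simp: finite_event_def)
      define W where "W = infprod (\<lambda>i. ?E (\<sigma> i) x powr (1 / conj_exp (ps i)))"
      have e: "prod_converges (\<lambda>i. ?E (f i) x)" "\<And>i. 0 \<le> ?E (f i) x"
        "infprod (\<lambda>i. ?E (f i) x) powr p \<le> S x * W powr p"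
        using elim xD by (auto simp: S_def W_def)
      have W: "0 \<le> W" unfolding W_def using elim xD by (intro infprod_nonneg) auto
      have "prod_converges (\<lambda>i. ?E (mass f i) x powr (p / ps i))"
        using infprod_powr(1)[OF elim(7) _ p] by (simp add: powr_powr)
      then have S: "0 \<le> S x" unfolding S_def by (intro infprod_nonneg) auto
      have "?E v x powr (1 / p) * W \<le> C" using elim n by (simp add: W_def)
      from powr_mono2[OF _ _ this, of p] have "?E v x * W powr p \<le> C powr p"
        using p W elim(2) by (simp add: powr_mult powr_powr)
      from mult_left_mono[OF this S]
      have "infprod (\<lambda>i. ?E (f i) x) powr p * ?E v x \<le> C powr p * S x"
        using mult_right_mono[OF e(3) elim(2)] by (simp add: ac_simps)
      then have "infprod (\<lambda>i. ?E (f i) x powr p) * ?E v x \<le> C powr p * S x"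
        by (simp add: infprod_powr(2)[OF e(1,2) p])
      then show "ennreal (infprod (\<lambda>i. ?E (f i) x powr p)) * ennreal (?E v x)
          \<le> ennreal (C powr p) * ennreal (S x)"
        using elim(2) S by (simp add: ennreal_mult'[symmetric] ennreal_mult''[symmetric] ennreal_leI)
    qed
  qed
  have "(\<integral>\<^sup>+x\<in>?D. ennreal (infprod (\<lambda>i. ?E (f i) x powr p)) * ennreal (v x) \<partial>M)
      = (\<integral>\<^sup>+x. (ennreal (infprod (\<lambda>i. ?E (f i) x powr p)) * indicator ?D x) * ennreal (v x) \<partial>M)"
    by (simp add: ac_simps)
  also have "\<dots> = (\<integral>\<^sup>+x. (ennreal (infprod (\<lambda>i. ?E (f i) x powr p)) * indicator ?D x) * ennreal (?E v x) \<partial>M)"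
    by (rule T.nn_integral_real_cond_exp[OF v(1,2), symmetric]) measurable
  also have "\<dots> \<le> (\<integral>\<^sup>+x. ennreal (C powr p) * ennreal (S x) \<partial>M)"
    by (rule nn_integral_mono_AE) (use ptw in eventually_elim, auto simp: indicator_def)
  also have "\<dots> = ennreal (C powr p) * (\<integral>\<^sup>+x. ennreal (S x) \<partial>M)"
    by (rule nn_integral_cmult) measurable
  also have "\<dots> \<le> ennreal (C powr p) * ennreal (norm_product f powr p)"
    unfolding S_def by (intro mult_left_mono cond_mass_product(2)[OF subT f]) simp
  also have "\<dots> = ennreal ((C * norm_product f) powr p)"
    by (simp add: ennreal_mult[symmetric] powr_mult)
  finally show ?thesis
    using C N p by (subst ennreal_powr_le_iff) auto
qed

text \<open>Stop at the first time at which the product of the conditional expectations exceeds \<open>t\<close>. The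
  stopping time is finite exactly where the maximal function exceeds \<open>t\<close>, and there the stopped
  product exceeds \<open>t\<close> as well.\<close>

lemma weak_type_of_stopped_bound:
  assumes f: "test_sequence M ps \<omega> f" and b: "0 \<le> b"
    and bound: "\<And>\<tau>. ext_stopping_time M F \<tau> \<Longrightarrow>
      ennreal_powr (\<integral>\<^sup>+x\<in>finite_event M \<tau>.
        ennreal (infprod (\<lambda>i. real_cond_exp M (stopped_algebra M F \<tau>) (f i) x powr p))
        * ennreal (v x) \<partial>M) (1 / p) \<le> ennreal b"
  shows "weak_Lq_norm M p v (doob_maximal M F f) \<le> ennreal b"
  unfolding weak_Lq_norm_def
proof (rule SUP_least)
  fix t :: real assume "t \<in> {0<..}"
  then have t: "0 < t" by simp
  define P where "P n x = infprod (\<lambda>i. \<bar>real_cond_exp M (F n) (f i) x\<bar>)" for n x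
  have [measurable]: "P n \<in> borel_measurable (F n)" for n unfolding P_def by measurable
  define \<tau> where "\<tau> x = (if \<exists>n. t < P n x then enat (LEAST n. t < P n x) else \<infinity>)" for x
  have \<tau>_le: "\<tau> x \<le> enat n \<longleftrightarrow> (\<exists>m\<le>n. t < P m x)" for x n
  proof
    assume "\<tau> x \<le> enat n"
    then have ex: "\<exists>n. t < P n x" and le: "(LEAST n. t < P n x) \<le> n"
      by (auto simp: \<tau>_def split: if_splits)
    from LeastI_ex[OF ex] le show "\<exists>m\<le>n. t < P m x" by (intro exI conjI)
  next
    assume "\<exists>m\<le>n. t < P m x"
    then obtain m where m: "m \<le> n" "t < P m x" by auto
    from Least_le[of "\<lambda>n. t < P n x", OF m(2)] m show "\<tau> x \<le> enat n" by (auto simp: \<tau>_def)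
  qed
  have \<tau>_eq: "t < P n x" if "\<tau> x = enat n" for x n
  proof -
    from that have ex: "\<exists>n. t < P n x" and eq: "(LEAST n. t < P n x) = n"
      by (auto simp: \<tau>_def split: if_splits)
    from LeastI_ex[OF ex] show ?thesis unfolding eq .
  qed
  have \<tau>: "ext_stopping_time M F \<tau>"
    unfolding ext_stopping_time_def
  proof
    fix n
    have "{x \<in> space (F m). t < P m x} \<in> sets (F m)" for m by measurable
    then have "{x \<in> space M. t < P m x} \<in> sets (F n)" if "m \<le> n" for m
      unfolding space_F by (rule sets_F_mono[OF that])
    then have "(\<Union>m\<in>{..n}. {x \<in> space M. t < P m x}) \<in> sets (F n)" by auto
    also have "(\<Union>m\<in>{..n}. {x \<in> space M. t < P m x}) = {x \<in> space M. \<tau> x \<le> enat n}"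
      by (auto simp: \<tau>_le)
    finally show "{x \<in> space M. \<tau> x \<le> enat n} \<in> sets (F n)" .
  qed
  have event: "{x \<in> space M. ennreal t < doob_maximal M F f x} = finite_event M \<tau>"
    using t by (auto simp: doob_maximal_def less_SUP_iff finite_event_def \<tau>_def P_def ennreal_less_iff)
  let ?E = "real_cond_exp M (stopped_algebra M F \<tau>)"
  note subT = subalgebra_stopped_algebra[OF \<tau>]
  have "AE x in M. \<forall>i n. \<tau> x = enat n \<longrightarrow> ?E (f i) x = real_cond_exp M (F n) (f i) x"
    by (subst AE_all_countable) (intro allI real_cond_exp_stopped_algebra[OF \<tau> test_sequenceD(3)[OF f]])
  then have ptw: "AE x in M. x \<in> finite_event M \<tau> \<longrightarrow> t powr p \<le> infprod (\<lambda>i. ?E (f i) x powr p)"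
    using cond_product_bound[OF subT f] dual_conv_stopped[OF \<tau>]
  proof eventually_elim
    case (elim x)
    show ?case
    proof
      assume xD: "x \<in> finite_event M \<tau>"
      then obtain n where n: "\<tau> x = enat n" by (auto simp: finite_event_def)
      have e: "prod_converges (\<lambda>i. ?E (f i) x)" "\<And>i. 0 \<le> ?E (f i) x" using elim xD by auto
      have "P n x = infprod (\<lambda>i. ?E (f i) x)"
        using elim(1) n e(2) by (simp add: P_def flip: elim(1)[rule_format, OF n])
      then have "t \<le> infprod (\<lambda>i. ?E (f i) x)" using \<tau>_eq[OF n] by simp
      then show "t powr p \<le> infprod (\<lambda>i. ?E (f i) x powr p)"
        unfolding infprod_powr(2)[OF e p] using t p by (intro powr_mono2) auto
    qed
  qed
  have "ennreal (t powr p) * weighted_measure M v (finite_event M \<tau>)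
      = (\<integral>\<^sup>+x\<in>finite_event M \<tau>. ennreal (t powr p) * ennreal (v x) \<partial>M)"
    unfolding weighted_measure_def
    using subT finite_event_stopped[OF \<tau>] v(3)
    by (subst nn_integral_cmult[symmetric]) (auto simp: subalgebra_def mult.assoc)
  also have "\<dots> \<le> (\<integral>\<^sup>+x\<in>finite_event M \<tau>. ennreal (infprod (\<lambda>i. ?E (f i) x powr p)) * ennreal (v x) \<partial>M)"
    by (rule nn_integral_mono_AE)
      (use ptw in eventually_elim, auto simp: indicator_def intro!: mult_right_mono ennreal_leI)
  also have "\<dots> \<le> ennreal (b powr p)"
    using bound[OF \<tau>] by (simp add: ennreal_powr_le_iff[OF p b])
  finally show "ennreal t * ennreal_powr (weighted_measure M v {x \<in> space M. ennreal t < doob_maximal M F f x}) (1 / p)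
      \<le> ennreal b"
    unfolding ennreal_mult_powr[OF p t] ennreal_powr_le_iff[OF p b] event .
qed

end

context dual_weights
begin

text \<open>The dual weight satisfies \<open>\<sigma>\<^sup>r \<omega> = \<sigma>\<close>, so restricted to a set it is its own mass.\<close>

lemma truncated_dual_mass:
  "AE x in M. \<forall>i. \<bar>indicator B x * \<sigma> i x\<bar> powr ps i * \<omega> i x = indicator B x * \<sigma> i x"
  using \<omega>_pos
  by eventually_elim (auto simp: indicator_def dual_weight_powr_times_weight[OF ps] dual_weight_nonneg)

lemma Lq_norm_truncated_dual:
  assumes [measurable]: "(indicator B :: 'a \<Rightarrow> real) \<in> borel_measurable M"
  shows "Lq_norm M (ps i) (\<omega> i) (\<lambda>x. indicator B x * \<sigma> i x)
    = (\<integral>x. indicator B x * \<sigma> i x \<partial>M) powr (1 / ps i)"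
proof -
  have [measurable]: "\<sigma> i \<in> borel_measurable M" "\<omega> i \<in> borel_measurable M"
    using \<sigma>_int weight_\<omega> by (auto simp: weight_def)
  have "(\<integral>x. \<bar>indicator B x * \<sigma> i x\<bar> powr ps i * \<omega> i x \<partial>M) = (\<integral>x. indicator B x * \<sigma> i x \<partial>M)"
    by (rule integral_cong_AE) (use truncated_dual_mass[of B] in auto)
  then show ?thesis by (simp add: Lq_norm_def)
qed

lemma Lq_norm_dual:
  "Lq_norm M (ps i) (\<omega> i) (\<sigma> i) = (\<integral>x. \<sigma> i x \<partial>M) powr (1 / ps i)"
  using Lq_norm_truncated_dual[of UNIV i] by simp

lemma truncated_dual_test_sequence:
  assumes conv: "prod_converges (\<lambda>i. Lq_norm M (ps i) (\<omega> i) (\<sigma> i))"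
    and B[measurable]: "B \<in> sets M"
  shows "test_sequence M ps \<omega> (\<lambda>i x. indicator B x * \<sigma> i x)"
    and "norm_product (\<lambda>i x. indicator B x * \<sigma> i x) powr p
      = infprod (\<lambda>i. (LINT x:B|M. \<sigma> i x) powr (p / ps i))"
proof -
  have [measurable]: "\<sigma> i \<in> borel_measurable M" "\<omega> i \<in> borel_measurable M" for i
    using \<sigma>_int weight_\<omega> by (auto simp: weight_def)
  have int_B: "integrable M (\<lambda>x. indicator B x * \<sigma> i x)" for i
    using integrable_mult_indicator[OF B \<sigma>_int, of i] by simp
  have nonneg: "0 \<le> (\<integral>x. indicator B x * \<sigma> i x \<partial>M)" for i
    by (intro Bochner_Integration.integral_nonneg) (simp add: dual_weight_nonneg)
  have c: "prod_converges (\<lambda>i. Lq_norm M (ps i) (\<omega> i) (\<lambda>x. indicator B x * \<sigma> i x))"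
  proof (rule prod_converges_comparison[OF conv])
    fix i
    show "0 \<le> Lq_norm M (ps i) (\<omega> i) (\<lambda>x. indicator B x * \<sigma> i x)" by (simp add: Lq_norm_def)
    have "(\<integral>x. indicator B x * \<sigma> i x \<partial>M) \<le> (\<integral>x. \<sigma> i x \<partial>M)"
      by (rule integral_mono[OF int_B \<sigma>_int]) (simp add: indicator_def dual_weight_nonneg)
    then show "Lq_norm M (ps i) (\<omega> i) (\<lambda>x. indicator B x * \<sigma> i x) \<le> Lq_norm M (ps i) (\<omega> i) (\<sigma> i)"
      unfolding Lq_norm_dual using ps[of i] nonneg
      by (subst Lq_norm_truncated_dual) (auto intro!: powr_mono2)
  qed
  have "in_Lq M (ps i) (\<omega> i) (\<lambda>x. indicator B x * \<sigma> i x)" for i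
    unfolding in_Lq_def
  proof
    show "integrable M (\<lambda>x. \<bar>indicator B x * \<sigma> i x\<bar> powr ps i * \<omega> i x)"
      by (rule integrable_cong_AE_imp[OF int_B[of i]]) (use truncated_dual_mass[of B] in auto)
  qed measurable
  then show "test_sequence M ps \<omega> (\<lambda>i x. indicator B x * \<sigma> i x)"
    using c by (auto simp: test_sequence_def dual_weight_nonneg)
  have "norm_product (\<lambda>i x. indicator B x * \<sigma> i x) powr p
      = infprod (\<lambda>i. Lq_norm M (ps i) (\<omega> i) (\<lambda>x. indicator B x * \<sigma> i x) powr p)"
    by (rule infprod_powr(2)[OF c _ p, symmetric]) (simp add: Lq_norm_def)
  then show "norm_product (\<lambda>i x. indicator B x * \<sigma> i x) powr p
      = infprod (\<lambda>i. (LINT x:B|M. \<sigma> i x) powr (p / ps i))"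
    by (subst (asm) Lq_norm_truncated_dual) (auto simp: powr_powr set_lebesgue_integral_def)
qed

text \<open>Positivity: let \<open>B\<close> be the set on which the product \<open>Q\<close> of the powers of the conditional dual
  weights vanishes. By the conditional Hoelder inequality the product of the powers of the dual weights
  themselves has integral zero over \<open>B\<close>; it is positive, so \<open>B\<close> is a null set.\<close>

lemma cond_dual_product:
  assumes G: "subalgebra M G"
    and conv: "prod_converges (\<lambda>i. Lq_norm M (ps i) (\<omega> i) (\<sigma> i))"
    and pos: "AE x in M. prod_converges (\<lambda>i. \<sigma> i x powr (1 / ps i)) \<and>
      infprod (\<lambda>i. \<sigma> i x powr (1 / ps i)) > 0"
  shows "AE x in M. prod_converges (\<lambda>i. real_cond_exp M G (\<sigma> i) x powr (1 / ps i))"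
    and "B \<in> sets G \<Longrightarrow>
      (\<integral>\<^sup>+x. indicator B x * ennreal (infprod (\<lambda>i. \<sigma> i x powr (p / ps i))) \<partial>M)
      \<le> (\<integral>\<^sup>+x. indicator B x * ennreal (infprod (\<lambda>i. real_cond_exp M G (\<sigma> i) x powr (p / ps i))) \<partial>M)"
    and "AE x in M. 0 < infprod (\<lambda>i. real_cond_exp M G (\<sigma> i) x powr (1 / ps i))"
proof -
  interpret G: sigma_finite_subalgebra M G by (rule sigma_finite_subalgebraI[OF G])
  have [measurable]: "\<sigma> i \<in> borel_measurable M" for i using \<sigma>_int by auto
  have nn: "AE x in M. 0 \<le> \<sigma> i x" for i by (simp add: dual_weight_nonneg)
  have conv': "prod_converges (\<lambda>i. (\<integral>x. \<sigma> i x \<partial>M) powr (p / ps i))"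
    using infprod_powr(1)[OF conv _ p] by (simp add: Lq_norm_dual powr_powr)
  define Q where "Q x = infprod (\<lambda>i. real_cond_exp M G (\<sigma> i) x powr (p / ps i))" for x
  have Q[measurable]: "Q \<in> borel_measurable G" unfolding Q_def by measurable
  have Q_conv: "AE x in M. prod_converges (\<lambda>i. real_cond_exp M G (\<sigma> i) x powr (p / ps i))"
    by (rule G.Hoelder_infprod_of_real_cond_exp(1)[OF prob_space_axioms \<sigma>_int nn exponents conv'])
  show Z_conv: "AE x in M. prod_converges (\<lambda>i. real_cond_exp M G (\<sigma> i) x powr (1 / ps i))"
    using Q_conv
  proof eventually_elim
    case (elim x)
    from infprod_powr(1)[OF elim, of "1 / p"] p show ?case by (simp add: powr_powr)
  qed
  show le: "(\<integral>\<^sup>+x. indicator B x * ennreal (infprod (\<lambda>i. \<sigma> i x powr (p / ps i))) \<partial>M)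
      \<le> (\<integral>\<^sup>+x. indicator B x * ennreal (infprod (\<lambda>i. real_cond_exp M G (\<sigma> i) x powr (p / ps i))) \<partial>M)"
    if "B \<in> sets G" for B
    by (rule G.cond_Hoelder_infprod(2)[OF prob_space_axioms \<sigma>_int nn exponents Q_conv that])
  define B where "B = {x \<in> space M. Q x = 0}"
  have sp: "space G = space M" using G by (simp add: subalgebra_def)
  have B: "B \<in> sets G" unfolding B_def sp[symmetric] by measurable
  then have [measurable]: "B \<in> sets M" using G by (auto simp: subalgebra_def)
  have "(\<integral>\<^sup>+x. indicator B x * ennreal (Q x) \<partial>M) = (\<integral>\<^sup>+x. 0 \<partial>M)"
    by (rule nn_integral_cong) (auto simp: B_def indicator_def)
  with le[OF B] have "(\<integral>\<^sup>+x. indicator B x * ennreal (infprod (\<lambda>i. \<sigma> i x powr (p / ps i))) \<partial>M) = 0"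
    by (simp add: Q_def)
  then have "AE x in M. indicator B x * ennreal (infprod (\<lambda>i. \<sigma> i x powr (p / ps i))) = 0"
    by (subst (asm) nn_integral_0_iff_AE) auto
  then show "AE x in M. 0 < infprod (\<lambda>i. real_cond_exp M G (\<sigma> i) x powr (1 / ps i))"
    using pos Z_conv AE_space
  proof eventually_elim
    case (elim x)
    have "infprod (\<lambda>i. \<sigma> i x powr (p / ps i)) = infprod (\<lambda>i. \<sigma> i x powr (1 / ps i)) powr p"
      using infprod_powr(2)[OF _ _ p, of "\<lambda>i. \<sigma> i x powr (1 / ps i)"] elim(2) by (simp add: powr_powr)
    with elim have "x \<notin> B" by (auto simp: indicator_def)
    moreover have "Q x = infprod (\<lambda>i. real_cond_exp M G (\<sigma> i) x powr (1 / ps i)) powr p"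
      using infprod_powr(2)[OF elim(3) _ p] by (simp add: powr_powr Q_def)
    moreover have "0 \<le> infprod (\<lambda>i. real_cond_exp M G (\<sigma> i) x powr (1 / ps i))"
      by (rule infprod_nonneg[OF elim(3)]) simp
    ultimately show ?case using elim(4) by (auto simp: B_def)
  qed
qed

end

context weighted_filtration
begin

text \<open>Write \<open>P\<close> for the product of the conditional expectations of the dual weights and \<open>Q\<close> for the
  product of their powers with exponents \<open>p / ps i\<close>. The weak-type inequality is tested with the dual
  weights restricted to a set \<open>B\<close> of \<open>F n\<close> on which \<open>P > q\<close>. The reverse Hoelder condition, for the
  stopping time that equals \<open>n\<close> on \<open>B\<close> and is infinite elsewhere, followed by the conditional Hoelder
  inequality, turns the product of norms into an integral of \<open>Q\<close> over \<open>B\<close>. As \<open>B\<close> is arbitrary,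
  \<open>q\<^sup>p E\<^sub>n(v) \<le> K Q\<close> where \<open>P > q\<close>, hence \<open>P\<^sup>p E\<^sub>n(v) \<le> K Q\<close>. Finally \<open>P = Z W\<close> and \<open>Q = Z\<^sup>p\<close> with
  \<open>Z > 0\<close>, where \<open>W\<close> is the product in the \<open>A\<close> condition, and \<open>Z\<^sup>p\<close> cancels.\<close>

lemma A_condition_of_weak_type:
  assumes conv: "prod_converges (\<lambda>i. Lq_norm M (ps i) (\<omega> i) (\<sigma> i))"
    and pos: "AE x in M. prod_converges (\<lambda>i. \<sigma> i x powr (1 / ps i)) \<and>
      infprod (\<lambda>i. \<sigma> i x powr (1 / ps i)) > 0"
    and C: "0 < C" and weak: "\<And>f. test_sequence M ps \<omega> f \<Longrightarrow>
      weak_Lq_norm M p v (doob_maximal M F f) \<le> ennreal (C * norm_product f)"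
    and R: "0 < R" and RH: "\<And>\<tau>. ext_stopping_time M F \<tau> \<Longrightarrow>
      ennreal (infprod (\<lambda>i. (LINT x:finite_event M \<tau>|M. \<sigma> i x) powr (p / ps i)))
      \<le> ennreal R * (\<integral>\<^sup>+x\<in>finite_event M \<tau>. ennreal (infprod (\<lambda>i. \<sigma> i x powr (p / ps i))) \<partial>M)"
  shows "AE x in M. real_cond_exp M (F n) v x powr (1 / p) *
    infprod (\<lambda>i. real_cond_exp M (F n) (\<sigma> i) x powr (1 / conj_exp (ps i))) \<le> (C powr p * R) powr (1 / p)"
proof -
  let ?E = "real_cond_exp M (F n)"
  interpret E: finite_measure_subalgebra M "F n" by unfold_locales (rule sub)
  define K where "K = C powr p * R"
  have K: "0 < K" using C R by (simp add: K_def)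
  define P where "P x = infprod (\<lambda>i. ?E (\<sigma> i) x)" for x
  define Q where "Q x = infprod (\<lambda>i. ?E (\<sigma> i) x powr (p / ps i))" for x
  have [measurable]: "P \<in> borel_measurable (F n)" "Q \<in> borel_measurable (F n)" "Q \<in> borel_measurable M"
    unfolding P_def Q_def by measurable
  have [measurable]: "\<sigma> i \<in> borel_measurable M" for i using \<sigma>_int by auto
  have E_nonneg: "AE x in M. \<forall>i. 0 \<le> ?E (\<sigma> i) x"
    unfolding AE_all_countable by (intro allI E.real_cond_exp_pos) (auto simp: dual_weight_nonneg)
  note dual = cond_dual_product[OF sub[of n] conv pos]
  have ZQ: "AE x in M. Q x = infprod (\<lambda>i. ?E (\<sigma> i) x powr (1 / ps i)) powr p"
    using dual(1)
  proof eventually_elim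
    case (elim x)
    from infprod_powr(2)[OF elim _ p] show ?case by (simp add: powr_powr Q_def)
  qed
  have testing: "ennreal (q powr p) * (\<integral>\<^sup>+x. indicator B x * ennreal (v x) \<partial>M)
      \<le> ennreal K * (\<integral>\<^sup>+x. indicator B x * ennreal (Q x) \<partial>M)"
    if q: "0 < q" and B: "B \<in> sets (F n)" and Bq: "\<And>x. x \<in> B \<Longrightarrow> q < P x" for q B
  proof -
    have BM[measurable]: "B \<in> sets M" by (rule sets_F[OF B])
    define f where "f i x = indicator B x * \<sigma> i x" for i x
    note f = truncated_dual_test_sequence[OF conv BM, folded f_def]
    have N: "0 \<le> norm_product f"
      using f(1) by (intro norm_product_powr(3)) (simp add: test_sequence_def)
    define \<tau> where "\<tau> x = (if x \<in> B then enat n else \<infinity>)" for x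
    have "{x \<in> space M. \<tau> x \<le> enat m} = (if n \<le> m then B else {})" for m
      using sets.sets_into_space[OF BM] by (auto simp: \<tau>_def)
    then have \<tau>: "ext_stopping_time M F \<tau>"
      using sets_F_mono[OF _ B] by (auto simp: ext_stopping_time_def)
    have fin: "finite_event M \<tau> = B"
      using sets.sets_into_space[OF BM] by (auto simp: \<tau>_def finite_event_def)
    have "AE x in M. \<forall>i. ?E (f i) x = indicator B x * ?E (\<sigma> i) x"
      unfolding AE_all_countable f_def
      using integrable_mult_indicator[OF BM \<sigma>_int] B
      by (intro allI E.real_cond_exp_mult) auto
    then have above: "AE x in M. x \<in> B \<longrightarrow> ennreal q < doob_maximal M F f x"
      using E_nonneg
    proof eventually_elim
      case (elim x)
      show ?case
      proof
        assume x: "x \<in> B"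
        then have "(\<lambda>i. \<bar>?E (f i) x\<bar>) = (\<lambda>i. ?E (\<sigma> i) x)" using elim by auto
        then have "ennreal q < ennreal (infprod (\<lambda>i. \<bar>?E (f i) x\<bar>))"
          using Bq[OF x] q by (simp add: P_def ennreal_less_iff)
        also have "\<dots> \<le> doob_maximal M F f x" unfolding doob_maximal_def by (rule SUP_upper) simp
        finally show "ennreal q < doob_maximal M F f x" .
      qed
    qed
    have "(\<integral>\<^sup>+x. indicator B x * ennreal (v x) \<partial>M)
        \<le> weighted_measure M v {x \<in> space M. ennreal q < doob_maximal M F f x}"
      unfolding weighted_measure_def
      by (rule nn_integral_mono_AE)
        (use above AE_space in eventually_elim, auto simp: indicator_def)
    then have "ennreal (q powr p) * (\<integral>\<^sup>+x. indicator B x * ennreal (v x) \<partial>M)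
        \<le> ennreal (q powr p) * weighted_measure M v {x \<in> space M. ennreal q < doob_maximal M F f x}"
      by (rule mult_left_mono) simp
    also have "\<dots> \<le> ennreal ((C * norm_product f) powr p)"
    proof -
      have "ennreal q * ennreal_powr (weighted_measure M v {x \<in> space M. ennreal q < doob_maximal M F f x}) (1 / p)
          \<le> weak_Lq_norm M p v (doob_maximal M F f)"
        unfolding weak_Lq_norm_def by (rule SUP_upper) (use q in simp)
      also have "\<dots> \<le> ennreal (C * norm_product f)" by (rule weak[OF f(1)])
      finally show ?thesis using C N by (simp add: ennreal_mult_powr[OF p q] ennreal_powr_le_iff[OF p])
    qed
    also have "\<dots> = ennreal (C powr p) * ennreal (infprod (\<lambda>i. (LINT x:B|M. \<sigma> i x) powr (p / ps i)))"
      by (simp add: powr_mult ennreal_mult' f(2))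
    also have "\<dots> \<le> ennreal (C powr p) *
        (ennreal R * (\<integral>\<^sup>+x\<in>B. ennreal (infprod (\<lambda>i. \<sigma> i x powr (p / ps i))) \<partial>M))"
      using RH[OF \<tau>] by (intro mult_left_mono) (auto simp: fin)
    also have "\<dots> = ennreal K * (\<integral>\<^sup>+x. indicator B x * ennreal (infprod (\<lambda>i. \<sigma> i x powr (p / ps i))) \<partial>M)"
      using R by (simp add: K_def ennreal_mult mult.assoc mult.commute[of "indicator B _"])
    also have "\<dots> \<le> ennreal K * (\<integral>\<^sup>+x. indicator B x * ennreal (Q x) \<partial>M)"
      unfolding Q_def by (intro mult_left_mono dual(2)[OF B]) simp
    finally show ?thesis .
  qed
  have level: "AE x in M. q < P x \<longrightarrow> q powr p * ?E v x \<le> K * Q x" if q: "0 < q" for q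
  proof -
    define D where "D = {x \<in> space M. q < P x}"
    have D[measurable]: "D \<in> sets (F n)" unfolding D_def space_F[of n, symmetric] by measurable
    have DM[measurable]: "D \<in> sets M" by (rule sets_F[OF D])
    have "AE x in M. q powr p * (indicator D x * ?E v x) \<le> K * Q x"
    proof (rule E.AE_le_of_nn_integral_le)
      show "integrable M (\<lambda>x. q powr p * (indicator D x * ?E v x))"
        using integrable_mult_indicator[OF DM E.real_cond_exp_int(1)[OF v(1)]] by simp
      show "AE x in M. 0 \<le> K * Q x" using ZQ by eventually_elim (use K in simp)
      fix B assume B[measurable]: "B \<in> sets (F n)"
      have [measurable]: "B \<in> sets M" by (rule sets_F[OF B])
      have "(\<integral>\<^sup>+x. indicator B x * ennreal (q powr p * (indicator D x * ?E v x)) \<partial>M)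
          = (\<integral>\<^sup>+x. ennreal (q powr p) * (indicator (B \<inter> D) x * ennreal (?E v x)) \<partial>M)"
        by (rule nn_integral_cong) (auto simp: indicator_def ennreal_mult')
      also have "\<dots> = ennreal (q powr p) * (\<integral>\<^sup>+x. indicator (B \<inter> D) x * ennreal (?E v x) \<partial>M)"
        by (rule nn_integral_cmult) measurable
      also have "(\<integral>\<^sup>+x. indicator (B \<inter> D) x * ennreal (?E v x) \<partial>M)
          = (\<integral>\<^sup>+x. indicator (B \<inter> D) x * ennreal (v x) \<partial>M)"
        by (rule E.nn_integral_real_cond_exp[OF v(1,2)]) measurable
      also have "ennreal (q powr p) * \<dots> \<le> ennreal K * (\<integral>\<^sup>+x. indicator (B \<inter> D) x * ennreal (Q x) \<partial>M)"
        by (rule testing[OF q]) (auto simp: D_def[symmetric] B D intro: sets.Int, auto simp: D_def)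
      also have "\<dots> = (\<integral>\<^sup>+x. ennreal K * (indicator (B \<inter> D) x * ennreal (Q x)) \<partial>M)"
        by (rule nn_integral_cmult[symmetric]) measurable
      also have "\<dots> \<le> (\<integral>\<^sup>+x. indicator B x * ennreal (K * Q x) \<partial>M)"
        using K by (intro nn_integral_mono) (auto simp: indicator_def ennreal_mult')
      finally show "(\<integral>\<^sup>+x. indicator B x * ennreal (q powr p * (indicator D x * ?E v x)) \<partial>M)
          \<le> (\<integral>\<^sup>+x. indicator B x * ennreal (K * Q x) \<partial>M)" .
    qed measurable
    then show ?thesis using AE_space by eventually_elim (auto simp: D_def)
  qed
  \<comment> \<open>Only countably many levels \<open>q\<close> can be treated outside one null set; the rational ones suffice.\<close>
  have "AE x in M. \<forall>q\<in>\<rat>. 0 < q \<longrightarrow> q < P x \<longrightarrow> q powr p * ?E v x \<le> K * Q x"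
    using level by (subst AE_ball_countable) (auto simp: countable_rat)
  moreover have "AE x in M. 0 \<le> ?E v x" by (rule E.real_cond_exp_pos) (auto intro: v)
  ultimately show ?thesis
    using dual(1) dual(3) ZQ E_nonneg dual_conv[of n]
  proof eventually_elim
    case (elim x)
    let ?W = "infprod (\<lambda>i. ?E (\<sigma> i) x powr (1 / conj_exp (ps i)))"
    let ?Z = "infprod (\<lambda>i. ?E (\<sigma> i) x powr (1 / ps i))"
    have W: "0 \<le> ?W" by (rule infprod_nonneg[OF elim(7)]) simp
    have "(\<lambda>i. ?E (\<sigma> i) x powr (1 / ps i) * ?E (\<sigma> i) x powr (1 / conj_exp (ps i))) = (\<lambda>i. ?E (\<sigma> i) x)"
      using elim(6) by (simp add: powr_add[symmetric] conj_exp_eq[OF ps])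
    with infprod_mult(2)[OF elim(3) elim(7)] have PZW: "P x = ?Z * ?W" by (simp add: P_def)
    have "?E v x * ?W powr p \<le> K"
    proof (rule ccontr)
      assume "\<not> ?E v x * ?W powr p \<le> K"
      then have gt: "K < ?E v x * ?W powr p" by simp
      with K elim(2) W have V: "0 < ?E v x" and W0: "0 < ?W"
        by (auto simp: less_le)
      \<comment> \<open>Then \<open>P\<^sup>p E\<^sub>n(v) > K Q\<close>, and a rational level slightly below \<open>P\<close> violates \<open>q\<^sup>p E\<^sub>n(v) \<le> K Q\<close>.\<close>
      have P: "0 < P x" using PZW W0 elim(4) by simp
      have "K * Q x < P x powr p * ?E v x"
        using gt elim(4) p by (simp add: PZW elim(5) powr_mult ac_simps)
      then have "K * Q x / ?E v x < P x powr p" using V by (simp add: field_simps)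
      moreover have KQ: "0 \<le> K * Q x / ?E v x" using K V by (simp add: elim(5))
      ultimately have "(K * Q x / ?E v x) powr (1 / p) < (P x powr p) powr (1 / p)"
        using p by (intro powr_less_mono2) auto
      then have "(K * Q x / ?E v x) powr (1 / p) < P x" using p P by (simp add: powr_powr)
      then obtain q where q: "q \<in> \<rat>" "(K * Q x / ?E v x) powr (1 / p) < q" "q < P x"
        using Rats_dense_in_real by blast
      have q0: "0 < q" by (rule le_less_trans[OF powr_ge_zero q(2)])
      have "((K * Q x / ?E v x) powr (1 / p)) powr p < q powr p"
        using p q by (intro powr_less_mono2) auto
      moreover have "1 / p * p = 1" using p by simp
      ultimately have "K * Q x / ?E v x < q powr p" by (simp only: powr_powr powr_one[OF KQ])
      then have "K * Q x < q powr p * ?E v x" using V by (simp add: field_simps)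
      with bspec[OF elim(1) q(1)] q(3) q0 show False by simp
    qed
    then have "(?E v x * ?W powr p) powr (1 / p) \<le> K powr (1 / p)"
      using p elim(2) by (intro powr_mono2) auto
    moreover have "(?E v x * ?W powr p) powr (1 / p) = ?E v x powr (1 / p) * ?W"
      using p W by (simp add: powr_mult powr_powr)
    ultimately show ?case by (simp add: K_def)
  qed
qed

end

theorem theorem1p1:
  fixes M :: "'a measure" and F :: "nat \<Rightarrow> 'a measure"
    and p :: real and ps :: "nat \<Rightarrow> real"
    and \<omega> :: "nat \<Rightarrow> 'a \<Rightarrow> real" and v :: "'a \<Rightarrow> real"
  assumes "prob_space M" and "complete_measure M"
    and "filtration (space M) F" and "\<And>n. subalgebra M (F n)"
    and "sets M = sigma_sets (space M) (\<Union>n. sets (F n))"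
    and "\<And>i. 1 < ps i" and "0 < p" and "(\<lambda>i. 1 / ps i) sums (1 / p)"
    and "\<And>i. weight M (\<omega> i)" and "weight M v"
    and A1: "\<And>i. integrable M (dual_weight (ps i) (\<omega> i))"
    and A2: "prod_converges (\<lambda>i. Lq_norm M (ps i) (\<omega> i) (dual_weight (ps i) (\<omega> i)))"
    and A3: "\<And>n. AE x in M. prod_converges (\<lambda>i.
               real_cond_exp M (F n) (\<lambda>y. \<omega> i y powr (1 - conj_exp (ps i))) x
                 powr (1 / conj_exp (ps i)))"
    and A4: "AE x in M. prod_converges (\<lambda>i. dual_weight (ps i) (\<omega> i) x powr (1 / ps i)) \<and>
               infprod (\<lambda>i. dual_weight (ps i) (\<omega> i) x powr (1 / ps i)) > 0"
    and RH: "reverse_Hoelder M F p ps \<omega>"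
  shows "((\<exists>C>0. \<forall>\<tau> f. ext_stopping_time M F \<tau> \<longrightarrow> test_sequence M ps \<omega> f \<longrightarrow>
             ennreal_powr (\<integral>\<^sup>+x\<in>finite_event M \<tau>.
                 ennreal (infprod (\<lambda>i. real_cond_exp M (stopped_algebra M F \<tau>) (f i) x powr p))
                 * ennreal (v x) \<partial>M) (1 / p)
             \<le> ennreal (C * infprod (\<lambda>i. Lq_norm M (ps i) (\<omega> i) (f i))))
         \<longleftrightarrow>
         (\<exists>C>0. \<forall>f. test_sequence M ps \<omega> f \<longrightarrow>
             weak_Lq_norm M p v (doob_maximal M F f)
             \<le> ennreal (C * infprod (\<lambda>i. Lq_norm M (ps i) (\<omega> i) (f i)))))
         \<and>
         ((\<exists>C>0. \<forall>f. test_sequence M ps \<omega> f \<longrightarrow>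
             weak_Lq_norm M p v (doob_maximal M F f)
             \<le> ennreal (C * infprod (\<lambda>i. Lq_norm M (ps i) (\<omega> i) (f i))))
         \<longleftrightarrow> A_class M F p ps v \<omega>)"
    (is "(?Stopped \<longleftrightarrow> ?Weak) \<and> (?Weak \<longleftrightarrow> _)")
proof -
  have \<sigma>_eq: "(\<lambda>y. \<omega> i y powr (1 - conj_exp (ps i))) = dual_weight (ps i) (\<omega> i)" for i
    by (rule ext) (simp add: dual_weight_eq assms(6))
  interpret prob_space M by fact
  interpret weighted_filtration M p ps \<omega> F v
    by unfold_locales (use assms A1 A3 in \<open>simp_all add: \<sigma>_eq
      filtration.space_F[OF assms(3)] filtration.sets_F_mono[OF assms(3)]\<close>)
  have "?Weak" if ?Stopped
  proof -
    from that obtain C where C: "0 < C" and stopped: "\<And>\<tau> f. ext_stopping_time M F \<tau> \<Longrightarrow>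
        test_sequence M ps \<omega> f \<Longrightarrow>
        ennreal_powr (\<integral>\<^sup>+x\<in>finite_event M \<tau>.
            ennreal (infprod (\<lambda>i. real_cond_exp M (stopped_algebra M F \<tau>) (f i) x powr p))
            * ennreal (v x) \<partial>M) (1 / p) \<le> ennreal (C * norm_product f)"
      by blast
    have "weak_Lq_norm M p v (doob_maximal M F f) \<le> ennreal (C * norm_product f)"
      if f: "test_sequence M ps \<omega> f" for f
    proof (rule weak_type_of_stopped_bound[OF f _ stopped[OF _ f]])
      have "0 \<le> norm_product f" using f by (intro norm_product_powr(3)) (simp add: test_sequence_def)
      then show "0 \<le> C * norm_product f" using C by simp
    qed
    with C show ?Weak by blast
  qed
  moreover have "A_class M F p ps v \<omega>" if ?Weak
  proof -
    from that obtain C where C: "0 < C" and weak: "\<And>f. test_sequence M ps \<omega> f \<Longrightarrow>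
        weak_Lq_norm M p v (doob_maximal M F f) \<le> ennreal (C * norm_product f)" by blast
    from RH obtain R where R: "0 < R" and RH': "\<And>\<tau>. ext_stopping_time M F \<tau> \<Longrightarrow>
      ennreal (infprod (\<lambda>i. (LINT x:finite_event M \<tau>|M. \<sigma> i x) powr (p / ps i)))
      \<le> ennreal R * (\<integral>\<^sup>+x\<in>finite_event M \<tau>. ennreal (infprod (\<lambda>i. \<sigma> i x powr (p / ps i))) \<partial>M)"
      unfolding reverse_Hoelder_def by blast
    show ?thesis
      unfolding A_class_def \<sigma>_eq AE_all_countable
      using A_condition_of_weak_type[OF A2 A4 C weak R RH'] C R
      by (intro exI[of _ "(C powr p * R) powr (1 / p)"]) simp
  qed
  moreover have ?Stopped if "A_class M F p ps v \<omega>"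
  proof -
    from that obtain C where C: "0 < C" and A: "AE x in M. \<forall>n. real_cond_exp M (F n) v x powr (1 / p) *
        infprod (\<lambda>i. real_cond_exp M (F n) (\<sigma> i) x powr (1 / conj_exp (ps i))) \<le> C"
      unfolding A_class_def \<sigma>_eq by blast
    from stopped_bound_of_A_condition[OF A C] C show ?Stopped by blast
  qed
  ultimately show ?thesis by blast
qed

end
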